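(* Non-tubular (umbilic-free) channel linear Weingarten surfaces in space forms, and their tangent plane congruences, are isothermic. That is, if $\mathfrak{f}:\Sigma^2\to\mathfrak{R}_{\mathfrak{p},\mathfrak{q}}$ is a non-tubular channel linear Weingarten surface with tangent plane congruence $\mathfrak{t}$, then the sphere congruences $\langle\mathfrak{f}\rangle$ and $\langle\mathfrak{t}\rangle$ are isothermic.
   Context: $\mathbb{R}^{4,2}$ is a $6$-dimensional real vector space with inner product $(\cdot,\cdot)$ of signature $(-++++-)$, and $L^5$ its light cone. Let $\mathfrak{p}$ be unit timelike, $(\mathfrak{p},\mathfrak{p})=-1$ (point sphere complex), and $\mathfrak{q}\neq 0$, $\mathfrak{q}\perp\mathfrak{p}$ (space form vector), $\kappa=-(\mathfrak{q},\mathfrak{q})$. Then $\mathfrak{R}_{\mathfrak{p},\mathfrak{q}}=\{x\in L^5:(x,\mathfrak{p})=0,(x,\mathfrak{q})=-1\}$ has constant curvature $\kappa$ and (each connected component) models a $3$-dimensional space form. Points of the Lie quadric $\mathcal{L}=\{\langle v\rangle: v\ne0,(v,v)=0\}$ represent oriented spheres; the planes of the space form are identified with $\mathfrak{T}_{\mathfrak{p},\mathfrak{q}}=\{x\in L^5:(x,\mathfrak{p})=-1,(x,\mathfrak{q})=0\}$. For a surface $\mathfrak{f}:\Sigma^2\to\mathfrak{R}_{\mathfrak{p},\mathfrak{q}}$ with tangent plane congruence $\mathfrak{t}:\Sigma^2\to\mathfrak{T}_{\mathfrak{p},\mathfrak{q}}$ ($(\mathfrak f,\mathfrak t)=(d\mathfrak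 f,\mathfrak t)=0$), the Legendre lift is $\Lambda=\langle\mathfrak{f},\mathfrak{t}\rangle$. $\Lambda$ envelops a sphere congruence $\langle\mathfrak{s}\rangle:\Sigma^2\to\mathcal{L}$ if $\mathfrak{s}(p)\in\Lambda(p)$ for all $p$. $\mathfrak{f}$ is a channel surface if $\Lambda$ envelops a $1$-parameter family of spheres. With principal curvatures $k_1,k_2$, $K=k_1k_2$ is the (extrinsic) Gauss curvature and $H=\frac{k_1+k_2}{2}$ the mean curvature. $\mathfrak{f}$ is linear Weingarten if $aK+2bH+c=0$ for some non-trivial triple of real constants $a,b,c$; it is tubular if $ac-b^2=0$, that is, if one of the principal curvatures is constant. A sphere congruence $s:\Sigma^2\to\mathcal{L}$ is isothermic if it has a Moutard lift, i.e. a lift $\mathfrak{s}$ with $\mathfrak{s}_{uv}\parallel\mathfrak{s}$ for some parameters $(u,v)$, which are then curvature line parameters.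
   Formalization: For ⟨t⟩ the claim is made only off the frontier of the set where ⟨t⟩ coincides with the enveloped sphere of the 1-parameter family; at such points (e.g. a nodoid's circles of extremal height) ⟨t⟩ has no Moutard lift, so the statement as worded fails there. *)

theory Defs
  imports "HOL-Analysis.Analysis"
begin

subsection \<open>Smooth maps and smooth surfaces\<close>

fun Ck_on :: "nat \<Rightarrow> 'a::real_normed_vector set \<Rightarrow> ('a \<Rightarrow> 'b::real_normed_vector) \<Rightarrow> bool" where
  "Ck_on 0 D g \<longleftrightarrow> continuous_on D g"
| "Ck_on (Suc k) D g \<longleftrightarrow>
     (\<forall>z\<in>D. g differentiable (at z)) \<and> (\<forall>X. Ck_on k D (\<lambda>z. frechet_derivative g (at z) X))"

text \<open>Intended for open \<open>D\<close> only.\<close>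

definition smooth_on :: "'a::real_normed_vector set \<Rightarrow> ('a \<Rightarrow> 'b::real_normed_vector) \<Rightarrow> bool" where
  "smooth_on D g \<longleftrightarrow> (\<forall>k. Ck_on k D g)"

text \<open>A chart is a pair of a domain and a coordinate map. The surface itself is the whole type
  \<open>'m\<close>; being Hausdorff and second countable is left to the type classes of \<open>'m\<close>.\<close>

type_synonym 'm chart = "'m set \<times> ('m \<Rightarrow> real \<times> real)"

definition coord_inv :: "'m chart \<Rightarrow> real \<times> real \<Rightarrow> 'm" where
  "coord_inv C = inv_into (fst C) (snd C)"

definition topological_chart :: "'m::topological_space chart \<Rightarrow> bool" where
  "topological_chart C \<longleftrightarrow> open (fst C) \<and> open (snd C ` fst C) \<and>
     homeomorphism (fst C) (snd C ` fst C) (snd C) (coord_inv C)"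

definition smooth_transition :: "'m chart \<Rightarrow> 'm chart \<Rightarrow> bool" where
  "smooth_transition C D \<longleftrightarrow> smooth_on (snd C ` (fst C \<inter> fst D)) (snd D \<circ> coord_inv C)"

definition smooth_surface :: "'m::topological_space chart set \<Rightarrow> bool" where
  "smooth_surface A \<longleftrightarrow> (\<forall>C\<in>A. topological_chart C) \<and> (\<Union>C\<in>A. fst C) = UNIV \<and>
     (\<forall>C\<in>A. \<forall>D\<in>A. smooth_transition C D)"

definition local_parameters :: "'m::topological_space chart set \<Rightarrow> 'm chart \<Rightarrow> bool" where
  "local_parameters A C \<longleftrightarrow> topological_chart C \<and>
     (\<forall>D\<in>A. smooth_transition C D \<and> smooth_transition D C)"

definition smooth_map_on :: "'m chart set \<Rightarrow> 'm set \<Rightarrow> ('m \<Rightarrow> 'b::real_normed_vector) \<Rightarrow> bool" where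
  "smooth_map_on A W g \<longleftrightarrow> (\<forall>C\<in>A. smooth_on (snd C ` (fst C \<inter> W)) (g \<circ> coord_inv C))"

text \<open>The differential at \<open>x\<close>, with tangent vectors represented in the chart \<open>C\<close>.\<close>

definition dif :: "'m chart \<Rightarrow> ('m \<Rightarrow> 'b::real_normed_vector) \<Rightarrow> 'm \<Rightarrow> real \<times> real \<Rightarrow> 'b" where
  "dif C g x = frechet_derivative (g \<circ> coord_inv C) (at (snd C x))"


subsection \<open>Lie sphere geometry\<close>

definition lie_inner :: "real^6 \<Rightarrow> real^6 \<Rightarrow> real" where
  "lie_inner x y = - x$1 * y$1 + x$2 * y$2 + x$3 * y$3 + x$4 * y$4 + x$5 * y$5 - x$6 * y$6"

definition light_cone :: "(real^6) set" where
  "light_cone = {x. lie_inner x x = 0}"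

definition lie_quadric :: "(real^6) set set" where
  "lie_quadric = {span {v} | v. v \<noteq> 0 \<and> lie_inner v v = 0}"

definition space_form :: "real^6 \<Rightarrow> real^6 \<Rightarrow> (real^6) set" where
  "space_form p q = {x \<in> light_cone. lie_inner x p = 0 \<and> lie_inner x q = -1}"

definition space_form_planes :: "real^6 \<Rightarrow> real^6 \<Rightarrow> (real^6) set" where
  "space_form_planes p q = {x \<in> light_cone. lie_inner x p = -1 \<and> lie_inner x q = 0}"

definition immersed_surface ::
  "'m chart set \<Rightarrow> real^6 \<Rightarrow> real^6 \<Rightarrow> ('m \<Rightarrow> real^6) \<Rightarrow> bool" where
  "immersed_surface A p q f \<longleftrightarrow> range f \<subseteq> space_form p q \<and> smooth_map_on A UNIV f \<and>
     (\<forall>C\<in>A. \<forall>x\<in>fst C. inj (dif C f x))"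

definition tangent_plane_congruence ::
  "'m chart set \<Rightarrow> real^6 \<Rightarrow> real^6 \<Rightarrow> ('m \<Rightarrow> real^6) \<Rightarrow> ('m \<Rightarrow> real^6) \<Rightarrow> bool" where
  "tangent_plane_congruence A p q f t \<longleftrightarrow>
     range t \<subseteq> space_form_planes p q \<and> smooth_map_on A UNIV t \<and>
     (\<forall>x. lie_inner (f x) (t x) = 0) \<and>
     (\<forall>C\<in>A. \<forall>x\<in>fst C. \<forall>X. lie_inner (dif C f x X) (t x) = 0)"

definition legendre_lift :: "('m \<Rightarrow> real^6) \<Rightarrow> ('m \<Rightarrow> real^6) \<Rightarrow> 'm \<Rightarrow> (real^6) set" where
  "legendre_lift f t x = span {f x, t x}"

definition envelops :: "('m \<Rightarrow> (real^6) set) \<Rightarrow> ('m \<Rightarrow> (real^6) set) \<Rightarrow> bool" where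
  "envelops \<Lambda> \<sigma> \<longleftrightarrow> (\<forall>x. \<sigma> x \<in> lie_quadric \<and> \<sigma> x \<subseteq> \<Lambda> x)"

text \<open>Locally, the spheres are taken from a smooth curve \<open>\<langle>\<gamma>\<rangle>\<close> in the Lie quadric, at parameter
  value \<open>w\<close>. The condition is local so that closed families, parametrised by a circle, are
  covered.\<close>

definition one_parameter_family ::
  "'m::topological_space chart set \<Rightarrow> ('m \<Rightarrow> (real^6) set) \<Rightarrow> bool" where
  "one_parameter_family A \<sigma> \<longleftrightarrow>
     (\<forall>x. \<exists>W J (w::'m \<Rightarrow> real) (\<gamma>::real \<Rightarrow> real^6).
        open W \<and> x \<in> W \<and> smooth_map_on A W w \<and> open J \<and> w ` W \<subseteq> J \<and> smooth_on J \<gamma> \<and>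
        (\<forall>y\<in>W. \<sigma> y = span {\<gamma> (w y)}))"


subsection \<open>Curvatures\<close>

text \<open>Rodrigues' equation \<open>dt + k df = 0\<close> in a principal direction: \<open>t - p\<close> is the unit normal of
  the surface, so these are the eigenvalues of its shape operator. As this is symmetric, there
  are one (at an umbilic) or two of them at each point.\<close>

definition principal_curvatures ::
  "'m chart set \<Rightarrow> ('m \<Rightarrow> real^6) \<Rightarrow> ('m \<Rightarrow> real^6) \<Rightarrow> 'm \<Rightarrow> real set" where
  "principal_curvatures A f t x =
     {k. \<exists>C\<in>A. x \<in> fst C \<and> (\<exists>X. X \<noteq> 0 \<and> dif C t x X + k *\<^sub>R dif C f x X = 0)}"

definition curv1 :: "'m chart set \<Rightarrow> ('m \<Rightarrow> real^6) \<Rightarrow> ('m \<Rightarrow> real^6) \<Rightarrow> 'm \<Rightarrow> real" where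
  "curv1 A f t x = Max (principal_curvatures A f t x)"

definition curv2 :: "'m chart set \<Rightarrow> ('m \<Rightarrow> real^6) \<Rightarrow> ('m \<Rightarrow> real^6) \<Rightarrow> 'm \<Rightarrow> real" where
  "curv2 A f t x = Min (principal_curvatures A f t x)"

definition gauss_curvature :: "'m chart set \<Rightarrow> ('m \<Rightarrow> real^6) \<Rightarrow> ('m \<Rightarrow> real^6) \<Rightarrow> 'm \<Rightarrow> real" where
  "gauss_curvature A f t x = curv1 A f t x * curv2 A f t x"

definition mean_curvature :: "'m chart set \<Rightarrow> ('m \<Rightarrow> real^6) \<Rightarrow> ('m \<Rightarrow> real^6) \<Rightarrow> 'm \<Rightarrow> real" where
  "mean_curvature A f t x = (curv1 A f t x + curv2 A f t x) / 2"

definition umbilic_free :: "'m chart set \<Rightarrow> ('m \<Rightarrow> real^6) \<Rightarrow> ('m \<Rightarrow> real^6) \<Rightarrow> bool" where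
  "umbilic_free A f t \<longleftrightarrow> (\<forall>x. curv1 A f t x \<noteq> curv2 A f t x)"

definition linear_weingarten ::
  "'m chart set \<Rightarrow> ('m \<Rightarrow> real^6) \<Rightarrow> ('m \<Rightarrow> real^6) \<Rightarrow> real \<Rightarrow> real \<Rightarrow> real \<Rightarrow> bool" where
  "linear_weingarten A f t a b c \<longleftrightarrow> (a, b, c) \<noteq> (0, 0, 0) \<and>
     (\<forall>x. a * gauss_curvature A f t x + 2 * b * mean_curvature A f t x + c = 0)"

definition tubular :: "real \<Rightarrow> real \<Rightarrow> real \<Rightarrow> bool" where
  "tubular a b c \<longleftrightarrow> a * c - b\<^sup>2 = 0"


subsection \<open>Isothermic sphere congruences\<close>

definition pd_u :: "(real \<times> real \<Rightarrow> 'b::real_normed_vector) \<Rightarrow> real \<times> real \<Rightarrow> 'b" where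
  "pd_u g z = frechet_derivative g (at z) (1, 0)"

definition pd_v :: "(real \<times> real \<Rightarrow> 'b::real_normed_vector) \<Rightarrow> real \<times> real \<Rightarrow> 'b" where
  "pd_v g z = frechet_derivative g (at z) (0, 1)"

text \<open>A lift cannot vanish where \<open>\<sigma>\<close> takes values in \<^const>\<open>lie_quadric\<close>.\<close>

definition moutard_lift ::
  "'m chart set \<Rightarrow> 'm chart \<Rightarrow> ('m \<Rightarrow> (real^6) set) \<Rightarrow> ('m \<Rightarrow> real^6) \<Rightarrow> bool" where
  "moutard_lift A C \<sigma> s \<longleftrightarrow> smooth_map_on A (fst C) s \<and>
     (\<forall>y\<in>fst C. span {s y} = \<sigma> y \<and> pd_v (pd_u (s \<circ> coord_inv C)) (snd C y) \<in> span {s y})"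

text \<open>Parameters exist only locally on a surface, hence \<open>\<sigma>\<close> is isothermic on \<open>W\<close> if each point
  of \<open>W\<close> has a neighbourhood with suitable parameters.\<close>

definition isothermic_on ::
  "'m::topological_space chart set \<Rightarrow> 'm set \<Rightarrow> ('m \<Rightarrow> (real^6) set) \<Rightarrow> bool" where
  "isothermic_on A W \<sigma> \<longleftrightarrow>
     (\<forall>x\<in>W. \<exists>C s. local_parameters A C \<and> x \<in> fst C \<and> moutard_lift A C \<sigma> s)"

text \<open>Pitfall: \<open>\<langle>t\<rangle>\<close> has no Moutard lift around an isolated coincidence of \<open>t\<close> with the enveloped
  1-parameter family. On a nodoid, at the circles of extremal height, the curvature \<open>k\<close> of the
  parallel circles is zero with non-zero derivative along the profile curve. Near such a circle
  a Moutard lift of \<open>\<langle>t\<rangle>\<close> is a multiple of \<open>t / k\<close> by factors without zeros, so it blows up there.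
  For this reason \<^const>\<open>isothermic_on\<close> takes the set of points \<open>W\<close> as an argument.\<close>

end

theory Submission
  imports Defs
begin

text \<open>Let the enveloped family be spanned locally by \<open>\<gamma>(w)\<close>. As \<open>\<langle>\<gamma>(w)\<rangle>\<close> lies in the span of \<open>f\<close>
  and \<open>t\<close>, scaling gives \<open>t = g(w) - k(w) f\<close>, and differentiation along a direction in the kernel
  of \<open>dw\<close> is Rodrigues' equation for \<open>k\<close>: the curvature of the enveloped spheres is a principal
  curvature. The linear Weingarten equation is affine in the other principal curvature \<open>l\<close>, and
  for a non-tubular surface it can be solved for it, so \<open>l\<close> is a function of \<open>w\<close> as well
  (\<open>channel_linear_weingarten_data\<close>).

  Let \<open>X\<close> be a principal direction for \<open>l\<close>. Differentiating \<open>t = g(w) - k(w) f\<close> along \<open>X\<close> and using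
  \<open>dt(X) = - l df(X)\<close> gives \<open>(k - l) df(X) = dw(X) (g'(w) - k'(w) f)\<close>, a linear ordinary
  differential equation for \<open>f\<close> along the integral curves of \<open>X\<close>, with coefficients that depend
  on \<open>w\<close> only. With an integrating factor \<open>\<rho>\<close>, \<open>\<rho>' = \<rho> k' / (k - l)\<close>, and with
  \<open>G' = \<rho> g' / (k - l)\<close>, the map \<open>F = \<rho>(w) f - G(w)\<close> is constant along \<open>X\<close>
  (\<open>channel_data_differential\<close>), while along the kernel of \<open>dw\<close> its derivative is \<open>\<rho> df\<close>, which
  does not vanish. Hence \<open>u = w\<close> and a suitable component \<open>v\<close> of \<open>F\<close> are coordinates in which
  \<open>F\<close> depends on \<open>v\<close> only (\<open>channel_data_coordinates\<close>).

  Then \<open>\<rho> f = G(u) + F\<close> has vanishing mixed derivative and is a Moutard lift of \<open>\<langle>f\<rangle>\<close>. Where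
  \<open>k \<noteq> 0\<close>, so is \<open>(\<rho> / k) t = (\<rho> g / k - G)(u) - F\<close> for \<open>\<langle>t\<rangle>\<close>; where \<open>k\<close> vanishes on an open
  set, \<open>t = g(u)\<close> itself is one. The zeros of \<open>k\<close> are the points at which \<open>\<langle>t\<rangle>\<close> is the enveloped
  sphere, so off the frontier of that set one of these two cases holds near each point.\<close>


section \<open>Calculus of smooth maps\<close>

lemma has_derivative_open_cong:
  assumes "open D" "\<And>z. z \<in> D \<Longrightarrow> g z = h z" "z \<in> D"
  shows "(g has_derivative d) (at z) \<longleftrightarrow> (h has_derivative d) (at z)"
  using has_derivative_transform_within_open[OF _ assms(1,3)] assms(2) by metis

lemma frechet_derivative_open_cong:
  assumes "open D" "\<And>z. z \<in> D \<Longrightarrow> g z = h z" "z \<in> D"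
  shows "frechet_derivative g (at z) = frechet_derivative h (at z)"
  unfolding frechet_derivative_def using has_derivative_open_cong[OF assms] by simp

lemma Ck_on_cong:
  assumes "open D" "\<And>z. z \<in> D \<Longrightarrow> g z = h z"
  shows "Ck_on k D g \<longleftrightarrow> Ck_on k D h"
  using assms(2)
proof (induction k arbitrary: g h)
  case 0
  then show ?case by (simp cong: continuous_on_cong)
next
  case (Suc k)
  have "g differentiable at z \<longleftrightarrow> h differentiable at z" if "z \<in> D" for z
    unfolding differentiable_def using has_derivative_open_cong[OF assms(1) Suc.prems that] by simp
  moreover have "Ck_on k D (\<lambda>z. frechet_derivative g (at z) X) \<longleftrightarrow>
      Ck_on k D (\<lambda>z. frechet_derivative h (at z) X)" for X
    by (rule Suc.IH) (simp add: frechet_derivative_open_cong[OF assms(1) Suc.prems])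
  ultimately show ?case by simp
qed

lemma Ck_on_subset: "Ck_on k D g \<Longrightarrow> D' \<subseteq> D \<Longrightarrow> Ck_on k D' g"
  by (induction k arbitrary: g) (auto intro: continuous_on_subset)

lemma Ck_on_SucI:
  assumes "open D" "\<And>z. z \<in> D \<Longrightarrow> (g has_derivative g' z) (at z)"
    and "\<And>X. Ck_on k D (\<lambda>z. g' z X)"
  shows "Ck_on (Suc k) D g"
proof -
  have "Ck_on k D (\<lambda>z. frechet_derivative g (at z) X) = Ck_on k D (\<lambda>z. g' z X)" for X
    by (rule Ck_on_cong[OF assms(1)]) (simp add: frechet_derivative_at[OF assms(2), symmetric])
  then show ?thesis
    using assms by (auto simp: differentiable_def)
qed

lemma Ck_on_SucD:
  assumes "Ck_on (Suc k) D g"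
  shows "z \<in> D \<Longrightarrow> (g has_derivative frechet_derivative g (at z)) (at z)"
    and "Ck_on k D (\<lambda>z. frechet_derivative g (at z) X)"
  using assms by (auto simp flip: frechet_derivative_works)

lemma Ck_on_Suc_imp: "Ck_on (Suc k) D g \<Longrightarrow> Ck_on k D g"
proof (induction k arbitrary: g)
  case 0
  then show ?case
    by (auto intro!: continuous_at_imp_continuous_on differentiable_imp_continuous_within)
next
  case (Suc k)
  then have "\<forall>X. Ck_on k D (\<lambda>z. frechet_derivative g (at z) X)"
    using Ck_on_SucD(2) by blast
  then show ?case using Suc.prems by simp
qed

lemma Ck_on_UN:
  assumes "\<And>i. i \<in> I \<Longrightarrow> open (D i)" "\<And>i. i \<in> I \<Longrightarrow> Ck_on k (D i) g"
  shows "Ck_on k (\<Union>i\<in>I. D i) g"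
  using assms(2)
proof (induction k arbitrary: g)
  case 0
  then show ?case using assms(1) by (auto intro: continuous_on_open_UN)
next
  case (Suc k)
  then show ?case by auto
qed

lemma Ck_on_const: "Ck_on k D (\<lambda>_. c)"
proof (induction k arbitrary: c)
  case (Suc k)
  have "frechet_derivative (\<lambda>_. c) (at z) = (\<lambda>_. 0)" for z :: 'a
    by (rule frechet_derivative_at[symmetric]) simp
  then show ?case using Suc by simp
qed simp

lemma Ck_on_bounded_linear: 
  assumes "open D" "bounded_linear L"
  shows "Ck_on k D L"
proof (cases k)
  case 0
  then show ?thesis using assms by (simp add: linear_continuous_on)
next
  case (Suc n)
  show ?thesis unfolding Suc
    by (rule Ck_on_SucI[OF assms(1) bounded_linear_imp_has_derivative[OF assms(2)]])
      (rule Ck_on_const)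
qed

lemma Ck_on_linear_compose:
  assumes "open D" "bounded_linear L" "Ck_on k D g"
  shows "Ck_on k D (\<lambda>z. L (g z))"
  using assms(3)
proof (induction k arbitrary: g)
  case 0
  then show ?case using bounded_linear.continuous_on[OF assms(2)] by simp
next
  case (Suc k)
  show ?case
    by (rule Ck_on_SucI[OF assms(1) bounded_linear.has_derivative[OF assms(2) Ck_on_SucD(1)[OF Suc.prems]]])
      (auto intro: Suc.IH Ck_on_SucD(2)[OF Suc.prems])
qed

lemma Ck_on_add:
  assumes "open D" "Ck_on k D g" "Ck_on k D h"
  shows "Ck_on k D (\<lambda>z. g z + h z)"
  using assms(2,3)
proof (induction k arbitrary: g h)
  case 0
  then show ?case by (auto intro: continuous_on_add)
next
  case (Suc k)
  show ?case
    by (rule Ck_on_SucI[OF assms(1) has_derivative_add[OF Ck_on_SucD(1)[OF Suc.prems(1)] 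
            Ck_on_SucD(1)[OF Suc.prems(2)]]])
      (auto intro: Suc.IH Ck_on_SucD(2)[OF Suc.prems(1)] Ck_on_SucD(2)[OF Suc.prems(2)])
qed

lemma Ck_on_sum:
  assumes "open D" "finite I" "\<And>i. i \<in> I \<Longrightarrow> Ck_on k D (g i)"
  shows "Ck_on k D (\<lambda>z. \<Sum>i\<in>I. g i z)"
  using assms(2,3) by (induction I rule: finite_induct) (auto intro: Ck_on_const Ck_on_add[OF assms(1)])

lemma Ck_on_bilinear:
  assumes "open D" "bounded_bilinear B" "Ck_on k D g" "Ck_on k D h"
  shows "Ck_on k D (\<lambda>z. B (g z) (h z))"
  using assms(3,4)
proof (induction k arbitrary: g h)
  case 0
  then show ?case using bounded_bilinear.continuous_on[OF assms(2)] by simp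
next
  case (Suc k)
  show ?case
    by (rule Ck_on_SucI[OF assms(1) bounded_bilinear.FDERIV[OF assms(2) 
            Ck_on_SucD(1)[OF Suc.prems(1)] Ck_on_SucD(1)[OF Suc.prems(2)]]])
      (assumption | intro Ck_on_add[OF assms(1)] Suc.IH Ck_on_SucD(2)[OF Suc.prems(1)]
        Ck_on_SucD(2)[OF Suc.prems(2)] Suc.prems[THEN Ck_on_Suc_imp])+
qed

text \<open>Membership in the class involves only directional derivatives in constant directions, so for
  the chain rule the derivative of the outer map is expanded over a basis.\<close>

lemma Ck_on_compose:
  fixes h :: "'b::euclidean_space \<Rightarrow> 'c::real_normed_vector"
  assumes "open D" "open E" "Ck_on k E h" "Ck_on k D g" "g ` D \<subseteq> E"
  shows "Ck_on k D (\<lambda>z. h (g z))"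
  using assms(3,4)
proof (induction k arbitrary: h)
  case 0
  then show ?case using assms(5) by (auto intro: continuous_on_compose2)
next
  case (Suc k)
  have d: "((\<lambda>z. h (g z)) has_derivative
      (\<lambda>X. \<Sum>b\<in>Basis. (frechet_derivative g (at z) X \<bullet> b) *\<^sub>R frechet_derivative h (at (g z)) b)) (at z)"
    if z: "z \<in> D" for z
  proof -
    have gz: "g z \<in> E" using z assms(5) by auto
    have dh: "(h has_derivative frechet_derivative h (at (g z))) (at (g z))"
      by (rule Ck_on_SucD(1)[OF Suc.prems(1) gz])
    have *: "((\<lambda>z. h (g z)) has_derivative
        (\<lambda>X. frechet_derivative h (at (g z)) (frechet_derivative g (at z) X))) (at z)"
      by (rule has_derivative_compose[OF Ck_on_SucD(1)[OF Suc.prems(2) z] dh])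
    have "frechet_derivative h (at (g z)) Y =
        (\<Sum>b\<in>Basis. (Y \<bullet> b) *\<^sub>R frechet_derivative h (at (g z)) b)" for Y
    proof -
      have "linear (frechet_derivative h (at (g z)))"
        using dh has_derivative_linear by blast
      then have "frechet_derivative h (at (g z)) (\<Sum>b\<in>Basis. (Y \<bullet> b) *\<^sub>R b) =
        (\<Sum>b\<in>Basis. (Y \<bullet> b) *\<^sub>R frechet_derivative h (at (g z)) b)"
        by (simp add: linear_sum linear_cmul)
      then show ?thesis by (simp add: euclidean_representation)
    qed
    then show ?thesis by (intro has_derivative_eq_rhs[OF *] ext)
  qed
  show ?case
  proof (rule Ck_on_SucI[OF assms(1) d])
    fix X
    show "Ck_on k D (\<lambda>z. \<Sum>b\<in>Basis. (frechet_derivative g (at z) X \<bullet> b) *\<^sub>R frechet_derivative h (at (g z)) b)"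
      by (intro Ck_on_sum[OF assms(1)] finite_Basis Ck_on_bilinear[OF assms(1) bounded_bilinear_scaleR]
          Ck_on_linear_compose[OF assms(1) bounded_linear_inner_left] Ck_on_SucD(2)[OF Suc.prems(2)]
          Suc.IH[OF Ck_on_SucD(2)[OF Suc.prems(1)] Ck_on_Suc_imp[OF Suc.prems(2)]])
  qed
qed

lemma Ck_on_inverse: "Ck_on k (- {0}) (inverse :: real \<Rightarrow> real)"
proof (induction k)
  case 0
  then show ?case by (auto intro!: continuous_intros)
next
  case (Suc k)
  have o: "open (- {0::real})" by auto
  show ?case
  proof (rule Ck_on_SucI[OF o])
    show "(inverse has_derivative (\<lambda>X. - (inverse z * X * inverse z))) (at z)" if "z \<in> - {0}" for z :: real
      using that has_derivative_inverse'[of z] by auto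
    show "Ck_on k (- {0}) (\<lambda>z. - (inverse z * X * inverse z))" for X :: real
      by (intro Ck_on_linear_compose[OF o bounded_linear_minus[OF bounded_linear_ident]]
          Ck_on_bilinear[OF o bounded_bilinear_mult] Suc Ck_on_const)
  qed
qed

lemma Ck_on_exp: "Ck_on k UNIV (exp :: real \<Rightarrow> real)"
proof (induction k)
  case 0
  then show ?case by (auto intro!: continuous_intros)
next
  case (Suc k)
  show ?case
  proof (rule Ck_on_SucI[OF open_UNIV])
    show "(exp has_derivative (\<lambda>X. exp z * X)) (at z)" for z :: real
      using DERIV_exp[of z] by (simp add: has_field_derivative_def)
    show "Ck_on k UNIV (\<lambda>z. exp z * X)" for X :: real
      by (intro Ck_on_bilinear[OF open_UNIV bounded_bilinear_mult] Suc Ck_on_const)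
  qed
qed

lemma smooth_on_has_derivative:
  "smooth_on D g \<Longrightarrow> z \<in> D \<Longrightarrow> (g has_derivative frechet_derivative g (at z)) (at z)"
  unfolding smooth_on_def using Ck_on_SucD(1) by blast

lemma smooth_on_frechet_derivative:
  "smooth_on D g \<Longrightarrow> smooth_on D (\<lambda>z. frechet_derivative g (at z) X)"
  unfolding smooth_on_def using Ck_on_SucD(2) by blast

lemma smooth_on_continuous_on: "smooth_on D g \<Longrightarrow> continuous_on D g"
  unfolding smooth_on_def using Ck_on.simps(1) by blast

lemma smooth_onI:
  assumes "open D" "\<And>z. z \<in> D \<Longrightarrow> (g has_derivative g' z) (at z)"
    and "\<And>X. smooth_on D (\<lambda>z. g' z X)"
  shows "smooth_on D g"
proof -
  have s: "Ck_on (Suc k) D g" for k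
    using assms by (intro Ck_on_SucI) (auto simp: smooth_on_def)
  have "Ck_on k D g" for k
    by (rule Ck_on_Suc_imp[OF s])
  then show ?thesis by (simp add: smooth_on_def)
qed

lemma smooth_on_cong:
  "open D \<Longrightarrow> (\<And>z. z \<in> D \<Longrightarrow> g z = h z) \<Longrightarrow> smooth_on D g \<longleftrightarrow> smooth_on D h"
  unfolding smooth_on_def using Ck_on_cong by metis

lemma smooth_on_subset: "smooth_on D g \<Longrightarrow> D' \<subseteq> D \<Longrightarrow> smooth_on D' g"
  unfolding smooth_on_def using Ck_on_subset by blast

lemma smooth_on_UN:
  "(\<And>i. i \<in> I \<Longrightarrow> open (D i)) \<Longrightarrow> (\<And>i. i \<in> I \<Longrightarrow> smooth_on (D i) g) \<Longrightarrow> smooth_on (\<Union>i\<in>I. D i) g"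
  unfolding smooth_on_def using Ck_on_UN by blast

lemma smooth_on_const: "smooth_on D (\<lambda>_. c)"
  unfolding smooth_on_def using Ck_on_const by blast

lemma smooth_on_bounded_linear: "open D \<Longrightarrow> bounded_linear L \<Longrightarrow> smooth_on D L"
  unfolding smooth_on_def using Ck_on_bounded_linear by blast

lemma smooth_on_linear_compose:
  "open D \<Longrightarrow> bounded_linear L \<Longrightarrow> smooth_on D g \<Longrightarrow> smooth_on D (\<lambda>z. L (g z))"
  unfolding smooth_on_def using Ck_on_linear_compose by blast

lemma smooth_on_add:
  "open D \<Longrightarrow> smooth_on D g \<Longrightarrow> smooth_on D h \<Longrightarrow> smooth_on D (\<lambda>z. g z + h z)"
  unfolding smooth_on_def using Ck_on_add by blast

lemma smooth_on_bilinear: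
  "open D \<Longrightarrow> bounded_bilinear B \<Longrightarrow> smooth_on D g \<Longrightarrow> smooth_on D h \<Longrightarrow> smooth_on D (\<lambda>z. B (g z) (h z))"
  unfolding smooth_on_def using Ck_on_bilinear by blast

lemma smooth_on_compose:
  fixes h :: "'b::euclidean_space \<Rightarrow> 'c::real_normed_vector"
  shows "open D \<Longrightarrow> open E \<Longrightarrow> smooth_on E h \<Longrightarrow> smooth_on D g \<Longrightarrow> g ` D \<subseteq> E \<Longrightarrow>
    smooth_on D (\<lambda>z. h (g z))"
  unfolding smooth_on_def using Ck_on_compose by blast

lemma smooth_on_uminus: "open D \<Longrightarrow> smooth_on D g \<Longrightarrow> smooth_on D (\<lambda>z. - g z)"
  by (rule smooth_on_linear_compose[OF _ bounded_linear_minus[OF bounded_linear_ident]])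

lemma smooth_on_diff:
  "open D \<Longrightarrow> smooth_on D g \<Longrightarrow> smooth_on D h \<Longrightarrow> smooth_on D (\<lambda>z. g z - h z)"
  using smooth_on_add[OF _ _ smooth_on_uminus, of D g h] by simp

lemma smooth_on_Pair:
  "open D \<Longrightarrow> smooth_on D g \<Longrightarrow> smooth_on D h \<Longrightarrow> smooth_on D (\<lambda>z. (g z, h z))"
proof -
  assume a: "open D" "smooth_on D g" "smooth_on D h"
  have b: "bounded_linear (\<lambda>x::'b. (x, 0::'c))" "bounded_linear (\<lambda>y::'c. (0::'b, y))"
    by (auto intro!: bounded_linear_Pair bounded_linear_ident bounded_linear_zero)
  show "smooth_on D (\<lambda>z. (g z, h z))"
    using smooth_on_add[OF a(1) smooth_on_linear_compose[OF a(1) b(1) a(2)]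
        smooth_on_linear_compose[OF a(1) b(2) a(3)]] by simp
qed

lemma smooth_on_inverse:
  fixes g :: "'a::real_normed_vector \<Rightarrow> real"
  assumes "open D" "smooth_on D g" "\<And>z. z \<in> D \<Longrightarrow> g z \<noteq> 0"
  shows "smooth_on D (\<lambda>z. inverse (g z))"
  by (rule smooth_on_compose[where E = "- {0}", OF assms(1) _ _ assms(2)])
    (use assms(3) Ck_on_inverse in \<open>auto simp: smooth_on_def\<close>)

lemma smooth_on_divide:
  fixes g h :: "'a::real_normed_vector \<Rightarrow> real"
  assumes "open D" "smooth_on D g" "smooth_on D h" "\<And>z. z \<in> D \<Longrightarrow> h z \<noteq> 0"
  shows "smooth_on D (\<lambda>z. g z / h z)"
  unfolding divide_inverse
  by (intro smooth_on_bilinear[OF assms(1) bounded_bilinear_mult] smooth_on_inverse assms)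

lemma smooth_on_exp:
  fixes g :: "'a::real_normed_vector \<Rightarrow> real"
  assumes "open D" "smooth_on D g"
  shows "smooth_on D (\<lambda>z. exp (g z))"
  by (rule smooth_on_compose[OF assms(1) open_UNIV _ assms(2)]) (auto simp: smooth_on_def Ck_on_exp)

lemmas smooth_on_scaleR = smooth_on_bilinear[OF _ bounded_bilinear_scaleR]
lemmas smooth_on_mult = smooth_on_bilinear[OF _ bounded_bilinear_mult]

lemma smooth_on_has_vector_derivative:
  assumes "smooth_on I h" "r \<in> I"
  shows "(h has_vector_derivative frechet_derivative h (at r) 1) (at r)"
proof -
  let ?d = "frechet_derivative h (at r)"
  have d: "(h has_derivative ?d) (at r)" by (rule smooth_on_has_derivative[OF assms])
  then have "?d X = X *\<^sub>R ?d 1" for X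
    using linear_cmul[OF has_derivative_linear[OF d], of X 1] by simp
  then have "?d = (\<lambda>X. X *\<^sub>R ?d 1)" by blast
  then show ?thesis using d by (simp add: has_vector_derivative_def)
qed

text \<open>An antiderivative is available on compact intervals, hence the passage to a smaller ball.\<close>

lemma smooth_antiderivative:
  fixes h :: "real \<Rightarrow> 'b::banach"
  assumes "0 < e" "smooth_on (ball r e) h"
  obtains d G where "0 < d" "d \<le> e" "smooth_on (ball r d) G"
    "\<And>x. x \<in> ball r d \<Longrightarrow> (G has_vector_derivative h x) (at x)"
proof -
  define d where "d = e / 2"
  have sub: "{r - d..r + d} \<subseteq> ball r e" using assms(1) by (auto simp: d_def dist_real_def)
  have "continuous_on {r - d..r + d} h"
    by (rule continuous_on_subset[OF smooth_on_continuous_on[OF assms(2)] sub])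
  then obtain G where G: "\<And>x. x \<in> {r - d..r + d} \<Longrightarrow>
      (G has_vector_derivative h x) (at x within {r - d..r + d})"
    using antiderivative_continuous by blast
  have bsub: "ball r d \<subseteq> {r - d..r + d}" by (auto simp: dist_real_def)
  have dG: "(G has_vector_derivative h x) (at x)" if "x \<in> ball r d" for x
  proof -
    have "(G has_vector_derivative h x) (at x within ball r d)"
      using bsub that by (intro has_vector_derivative_within_subset[OF G bsub]) blast
    then show ?thesis using at_within_open[OF that open_ball] by simp
  qed
  have "smooth_on (ball r d) G"
  proof (rule smooth_onI[OF open_ball])
    show "(G has_derivative (\<lambda>X. X *\<^sub>R h x)) (at x)" if "x \<in> ball r d" for x
      using dG[OF that] by (simp add: has_vector_derivative_def)
    show "smooth_on (ball r d) (\<lambda>x. X *\<^sub>R h x)" for X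
      using smooth_on_subset[OF assms(2)] sub bsub
      by (intro smooth_on_scaleR smooth_on_const open_ball) auto
  qed
  with dG show ?thesis using assms(1) by (intro that[of d G]) (auto simp: d_def)
qed

section \<open>Linear maps of the plane\<close>

lemma plane_parallel:
  fixes X Y :: "real \<times> real"
  assumes "fst X * snd Y = snd X * fst Y" "X \<noteq> 0"
  obtains c where "Y = c *\<^sub>R X"
proof (cases "fst X = 0")
  case True
  then have "snd X \<noteq> 0" using assms(2) by (simp add: prod_eq_iff)
  then have "Y = (snd Y / snd X) *\<^sub>R X"
    using True assms(1) by (simp add: prod_eq_iff)
  then show ?thesis by (rule that)
next
  case False
  then have "Y = (fst Y / fst X) *\<^sub>R X"
    using assms(1) by (simp add: prod_eq_iff field_simps)
  then show ?thesis by (rule that)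
qed

lemma linear_plane:
  fixes L :: "real \<times> real \<Rightarrow> 'b::real_vector"
  assumes "linear L"
  shows "L X = fst X *\<^sub>R L (1, 0) + snd X *\<^sub>R L (0, 1)"
proof -
  have "X = fst X *\<^sub>R (1, 0) + snd X *\<^sub>R (0, 1)" by (simp add: prod_eq_iff)
  then show ?thesis using linear_add[OF assms] linear_cmul[OF assms] by metis
qed

lemma linear_plane_kernel:
  fixes L :: "real \<times> real \<Rightarrow> real"
  assumes "linear L"
  obtains X where "X \<noteq> 0" "L X = 0"
proof (cases "L (1, 0) = 0")
  case True
  then show ?thesis by (intro that[of "(1, 0)"]) (auto simp: prod_eq_iff)
next
  case False
  then show ?thesis
    using linear_plane[OF assms, of "(- L (0, 1), L (1, 0))"]
    by (intro that[of "(- L (0, 1), L (1, 0))"]) (auto simp: prod_eq_iff)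
qed

lemma linear_plane_kernel_parallel:
  fixes L :: "real \<times> real \<Rightarrow> real"
  assumes "linear L" "L Y \<noteq> 0" "L X = 0" "L Z = 0" "X \<noteq> 0"
  obtains c where "Z = c *\<^sub>R X"
proof -
  let ?a = "L (1, 0)" and ?b = "L (0, 1)"
  have X: "fst X * ?a + snd X * ?b = 0" and Z: "fst Z * ?a + snd Z * ?b = 0"
    using assms(3,4) linear_plane[OF assms(1), of X] linear_plane[OF assms(1), of Z] by auto
  have ab: "?a \<noteq> 0 \<or> ?b \<noteq> 0" using assms(2) linear_plane[OF assms(1), of Y] by auto
  have "(fst X * snd Z - snd X * fst Z) * ?a = 
      snd Z * (fst X * ?a + snd X * ?b) - snd X * (fst Z * ?a + snd Z * ?b)"
    "(fst X * snd Z - snd X * fst Z) * ?b = 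
      fst X * (fst Z * ?a + snd Z * ?b) - fst Z * (fst X * ?a + snd X * ?b)"
    by (simp_all add: algebra_simps)
  then have "fst X * snd Z = snd X * fst Z" using X Z ab by auto
  then show ?thesis using plane_parallel assms(5) that by blast
qed

lemma pencil_eigenvalue_unique:
  fixes P T :: "real \<times> real \<Rightarrow> 'b::real_vector"
  assumes "linear P" "inj P" "X \<noteq> 0" "T X + k *\<^sub>R P X = 0" "T X + l *\<^sub>R P X = 0"
  shows "k = l"
proof -
  have "(k - l) *\<^sub>R P X = (T X + k *\<^sub>R P X) - (T X + l *\<^sub>R P X)" by (simp add: algebra_simps)
  then have "(k - l) *\<^sub>R P X = 0" using assms(4,5) by simp
  moreover have "P X \<noteq> 0" using linear_injective_0[OF assms(1)] assms(2,3) by blast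
  ultimately show ?thesis by simp
qed

text \<open>Three eigenvectors in the plane are linearly dependent, whereas eigenvectors for two different
  eigenvalues are not. A relation \<open>d Z = a X + b Y\<close>, to which \<open>T + m P\<close> is applied, then forces
  \<open>a (m - k) = b (m - l) = 0\<close> by injectivity of \<open>P\<close>.\<close>

lemma pencil_eigenvalues_two:
  fixes P T :: "real \<times> real \<Rightarrow> 'b::real_vector"
  assumes "linear P" "linear T" "inj P" "X \<noteq> 0" "Y \<noteq> 0" "Z \<noteq> 0"
    and X: "T X + k *\<^sub>R P X = 0" and Y: "T Y + l *\<^sub>R P Y = 0" and Z: "T Z + m *\<^sub>R P Z = 0"
    and "k \<noteq> l"
  shows "m = k \<or> m = l"
proof (rule ccontr)
  assume m: "\<not> (m = k \<or> m = l)"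
  have indep: "fst X * snd Y \<noteq> snd X * fst Y"
  proof
    assume "fst X * snd Y = snd X * fst Y"
    then obtain c where c: "Y = c *\<^sub>R X" using plane_parallel assms(4) by blast
    then have "c \<noteq> 0" using assms(5) by auto
    have "c *\<^sub>R (T X + l *\<^sub>R P X) = 0"
      using Y c linear_cmul[OF assms(1)] linear_cmul[OF assms(2)] by (simp add: algebra_simps)
    then have "T X + l *\<^sub>R P X = 0" using \<open>c \<noteq> 0\<close> by simp
    then show False using pencil_eigenvalue_unique[OF assms(1,3,4), of T k l] X assms(10) by blast
  qed
  let ?d = "fst X * snd Y - snd X * fst Y"
  define a where "a = fst Z * snd Y - snd Z * fst Y"
  define b where "b = fst X * snd Z - snd X * fst Z"
  \<comment> \<open>Cramer's rule, without division by the determinant of \<open>X\<close> and \<open>Y\<close>\<close>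
  have Zab: "?d *\<^sub>R Z = a *\<^sub>R X + b *\<^sub>R Y"
    by (simp add: prod_eq_iff a_def b_def algebra_simps)
  have TX: "T X = - k *\<^sub>R P X" and TY: "T Y = - l *\<^sub>R P Y" and TZ: "T Z = - m *\<^sub>R P Z"
    using X Y Z by (simp_all add: eq_neg_iff_add_eq_0)
  have Zab': "?d *\<^sub>R L Z = a *\<^sub>R L X + b *\<^sub>R L Y" if L: "linear L" for L :: "real \<times> real \<Rightarrow> 'b"
    using arg_cong[OF Zab, of L] linear_add[OF L] linear_cmul[OF L] by simp
  have "(a * (m - k)) *\<^sub>R P X + (b * (m - l)) *\<^sub>R P Y =
      (a *\<^sub>R T X + b *\<^sub>R T Y) + m *\<^sub>R (a *\<^sub>R P X + b *\<^sub>R P Y)"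
    by (simp add: TX TY algebra_simps)
  also have "\<dots> = ?d *\<^sub>R T Z + m *\<^sub>R (?d *\<^sub>R P Z)"
    by (simp only: Zab'[OF assms(1)] Zab'[OF assms(2)])
  also have "\<dots> = ?d *\<^sub>R (T Z + m *\<^sub>R P Z)"
    by (simp only: scaleR_add_right scaleR_left_commute[of m])
  also have "\<dots> = 0" using Z by simp
  finally have "P ((a * (m - k)) *\<^sub>R X + (b * (m - l)) *\<^sub>R Y) = 0"
    using linear_add[OF assms(1)] linear_cmul[OF assms(1)] by simp
  then have "(a * (m - k)) *\<^sub>R X + (b * (m - l)) *\<^sub>R Y = 0"
    using linear_injective_0[OF assms(1)] assms(3) by blast
  then have e: "a * (m - k) * fst X + b * (m - l) * fst Y = 0"
    "a * (m - k) * snd X + b * (m - l) * snd Y = 0"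
    by (simp_all add: prod_eq_iff)
  have "a * (m - k) * ?d = 
      snd Y * (a * (m - k) * fst X + b * (m - l) * fst Y) - fst Y * (a * (m - k) * snd X + b * (m - l) * snd Y)"
    "b * (m - l) * ?d = 
      fst X * (a * (m - k) * snd X + b * (m - l) * snd Y) - snd X * (a * (m - k) * fst X + b * (m - l) * fst Y)"
    by (simp_all add: algebra_simps)
  then have "a = 0" "b = 0" using e m indep by auto
  then have "?d *\<^sub>R Z = 0" using Zab by simp
  then show False using indep assms(6) by auto
qed


section \<open>The inverse function theorem in the plane\<close>

text \<open>By Cramer's rule the derivative of the inverse at \<open>y\<close> is a smooth function of the inverse
  itself; hence each derivative already known to exist yields the next one.\<close>

lemma smooth_inverse_plane:
  fixes \<psi> :: "real \<times> real \<Rightarrow> real \<times> real"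
  assumes "open U" "smooth_on U \<psi>" "open V" "homeomorphism U V \<psi> \<theta>"
    and d: "\<And>y. y \<in> V \<Longrightarrow> (\<theta> has_derivative \<theta>' y) (at y)"
    and inv: "\<And>y. y \<in> V \<Longrightarrow> \<theta>' y = inv (frechet_derivative \<psi> (at (\<theta> y)))"
    and bij: "\<And>y. y \<in> V \<Longrightarrow> bij (frechet_derivative \<psi> (at (\<theta> y)))"
  shows "smooth_on V \<theta>"
proof -
  define a where "a z = fst (frechet_derivative \<psi> (at z) (1, 0))" for z
  define b where "b z = fst (frechet_derivative \<psi> (at z) (0, 1))" for z
  define c where "c z = snd (frechet_derivative \<psi> (at z) (1, 0))" for z
  define e where "e z = snd (frechet_derivative \<psi> (at z) (0, 1))" for z
  define \<Delta> where "\<Delta> z = a z * e z - b z * c z" for z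
  define H where "H X z = ((e z * fst X - b z * snd X) / \<Delta> z, (a z * snd X - c z * fst X) / \<Delta> z)"
    for X z
  have \<theta>: "\<theta> ` V = U" using assms(4) by (simp add: homeomorphism_def)
  have D: "frechet_derivative \<psi> (at z) X = (a z * fst X + b z * snd X, c z * fst X + e z * snd X)"
    if "z \<in> U" for z X
  proof -
    have l: "linear (frechet_derivative \<psi> (at z))"
      using smooth_on_has_derivative[OF assms(2) that] has_derivative_linear by blast
    show ?thesis
      by (subst linear_plane[OF l]) (simp add: a_def b_def c_def e_def prod_eq_iff algebra_simps)
  qed
  have \<Delta>0: "\<Delta> (\<theta> y) \<noteq> 0" if y: "y \<in> V" for y
  proof
    let ?z = "\<theta> y"
    assume "\<Delta> ?z = 0"
    then have \<Delta>: "a ?z * e ?z = b ?z * c ?z" by (simp add: \<Delta>_def)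
    have z: "?z \<in> U" using \<theta> y by auto
    have inj: "inj (frechet_derivative \<psi> (at ?z))" using bij[OF y] by (simp add: bij_def)
    have 0: "frechet_derivative \<psi> (at ?z) (0, 0) = (0, 0)" using D[OF z] by simp
    have "frechet_derivative \<psi> (at ?z) (b ?z, - a ?z) = (0, 0)"
      "frechet_derivative \<psi> (at ?z) (e ?z, - c ?z) = (0, 0)"
      using \<Delta> by (simp_all add: D[OF z] algebra_simps)
    then have "(b ?z, - a ?z) = (0, 0)" "(e ?z, - c ?z) = (0, 0)"
      using injD[OF inj] 0 by metis+
    then have "frechet_derivative \<psi> (at ?z) (1, 0) = frechet_derivative \<psi> (at ?z) (0, 0)"
      by (simp add: D[OF z])
    then show False using injD[OF inj] by fastforce
  qed
  have H: "\<theta>' y X = H X (\<theta> y)" if y: "y \<in> V" for y X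
  proof -
    have "?thesis \<longleftrightarrow> frechet_derivative \<psi> (at (\<theta> y)) (H X (\<theta> y)) = X"
      unfolding inv[OF y] using bij[OF y] by (metis bij_inv_eq_iff)
    moreover have "frechet_derivative \<psi> (at (\<theta> y)) (H X (\<theta> y)) = X"
    proof -
      have z: "\<theta> y \<in> U" using \<theta> y by auto
      have "a (\<theta> y) * (e (\<theta> y) * fst X - b (\<theta> y) * snd X) +
          b (\<theta> y) * (a (\<theta> y) * snd X - c (\<theta> y) * fst X) = fst X * \<Delta> (\<theta> y)"
        "c (\<theta> y) * (e (\<theta> y) * fst X - b (\<theta> y) * snd X) +
          e (\<theta> y) * (a (\<theta> y) * snd X - c (\<theta> y) * fst X) = snd X * \<Delta> (\<theta> y)"
        by (simp_all add: \<Delta>_def algebra_simps)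
      then show ?thesis
        using \<Delta>0[OF y]
        by (simp add: D[OF z] H_def prod_eq_iff add_divide_distrib[symmetric])
    qed
    ultimately show ?thesis by simp
  qed
  have \<Delta>0': "\<Delta> z \<noteq> 0" if "z \<in> U" for z using \<Delta>0 \<theta> that by auto
  have sH: "smooth_on U (H X)" for X
    unfolding H_def[abs_def] \<Delta>_def
    by (intro smooth_on_Pair smooth_on_divide smooth_on_diff smooth_on_mult smooth_on_const
        assms(1) \<Delta>0'[unfolded \<Delta>_def])
      (auto simp: a_def b_def c_def e_def intro!: smooth_on_linear_compose[OF assms(1) bounded_linear_fst]
        smooth_on_linear_compose[OF assms(1) bounded_linear_snd] smooth_on_frechet_derivative assms(2))
  have "Ck_on k V \<theta>" for k
  proof (induction k)
    case 0
    then show ?case using assms(4) by (simp add: homeomorphism_def)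
  next
    case (Suc k)
    show ?case
    proof (rule Ck_on_SucI[OF assms(3)])
      show "(\<theta> has_derivative (\<lambda>X. H X (\<theta> y))) (at y)" if "y \<in> V" for y
        by (intro has_derivative_eq_rhs[OF d[OF that]] ext H that)
      show "Ck_on k V (\<lambda>y. H X (\<theta> y))" for X
        using sH by (intro Ck_on_compose[OF assms(3,1) _ Suc]) (auto simp: smooth_on_def \<theta>)
    qed
  qed
  then show ?thesis by (simp add: smooth_on_def)
qed

text \<open>The standard theorem provides a differentiable inverse; the previous lemma makes it smooth.\<close>

lemma inverse_function_plane:
  fixes \<psi> :: "real \<times> real \<Rightarrow> real \<times> real"
  assumes "open U" "smooth_on U \<psi>" "z \<in> U" "inj (frechet_derivative \<psi> (at z))"
  obtains U' V \<theta> where "open U'" "U' \<subseteq> U" "z \<in> U'" "open V" "homeomorphism U' V \<psi> \<theta>" "smooth_on V \<theta>"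
proof -
  define \<psi>' where "\<psi>' z = Blinfun (frechet_derivative \<psi> (at z))" for z
  have ap: "blinfun_apply (\<psi>' y) = frechet_derivative \<psi> (at y)" if "y \<in> U" for y
    unfolding \<psi>'_def
    using smooth_on_has_derivative[OF assms(2) that]
    by (intro bounded_linear_Blinfun_apply) (rule has_derivative_bounded_linear)
  have der: "(\<psi> has_derivative blinfun_apply (\<psi>' y)) (at y)" if "y \<in> U" for y
    using smooth_on_has_derivative[OF assms(2) that] ap[OF that] by simp
  have cont: "continuous_on U \<psi>'"
  proof (rule continuous_on_blinfun_componentwise)
    fix i :: "real \<times> real"
    have "continuous_on U (\<lambda>y. frechet_derivative \<psi> (at y) i)"
      by (intro smooth_on_continuous_on smooth_on_frechet_derivative assms(2))
    then show "continuous_on U (\<lambda>y. blinfun_apply (\<psi>' y) i)"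
      by (rule continuous_on_cong[THEN iffD1, rotated -1]) (simp_all add: ap)
  qed
  have lin: "linear (frechet_derivative \<psi> (at z))"
    using smooth_on_has_derivative[OF assms(2,3)] has_derivative_linear by blast
  obtain L where L: "linear L" "L \<circ> frechet_derivative \<psi> (at z) = id"
    using linear_injective_left_inverse[OF lin assms(4)] by blast
  have "Blinfun L o\<^sub>L \<psi>' z = id_blinfun"
  proof (rule blinfun_eqI)
    fix X
    show "blinfun_apply (Blinfun L o\<^sub>L \<psi>' z) X = blinfun_apply id_blinfun X"
      using fun_cong[OF L(2), of X] linear_conv_bounded_linear[of L] L(1)
      by (simp add: ap[OF assms(3)] bounded_linear_Blinfun_apply)
  qed
  then obtain U' V \<theta> \<theta>' where *: "open U'" "U' \<subseteq> U" "z \<in> U'" "open V" "homeomorphism U' V \<psi> \<theta>"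
    and **: "\<And>y. y \<in> V \<Longrightarrow> (\<theta> has_derivative \<theta>' y) (at y)"
      "\<And>y. y \<in> V \<Longrightarrow> \<theta>' y = inv (blinfun_apply (\<psi>' (\<theta> y)))"
      "\<And>y. y \<in> V \<Longrightarrow> bij (blinfun_apply (\<psi>' (\<theta> y)))"
    using inverse_function_theorem[OF assms(1) der cont assms(3)] by metis
  have \<theta>: "\<theta> y \<in> U" if "y \<in> V" for y using * that by (auto simp: homeomorphism_def)
  have "smooth_on V \<theta>"
    by (rule smooth_inverse_plane[OF *(1) smooth_on_subset[OF assms(2) *(2)] *(4,5) **(1)])
      (use ** ap \<theta> in auto)
  with * show ?thesis using that by blast
qed

section \<open>Charts and maps on a surface\<close>

lemma coord_inv_apply: "topological_chart C \<Longrightarrow> y \<in> fst C \<Longrightarrow> coord_inv C (snd C y) = y"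
  unfolding topological_chart_def using homeomorphism_apply1 by metis

lemma open_chart_image:
  assumes "topological_chart C" "open W"
  shows "open (snd C ` (fst C \<inter> W))"
proof -
  have "openin (top_of_set (snd C ` fst C)) (snd C ` (fst C \<inter> W))"
    using assms unfolding topological_chart_def
    by (intro homeomorphism_imp_open_map[of "fst C" _ "snd C" "coord_inv C"]) auto
  then show ?thesis
    using assms(1) openin_open_trans unfolding topological_chart_def by blast
qed

lemma smooth_surface_local_parameters:
  "smooth_surface A \<Longrightarrow> C \<in> A \<Longrightarrow> local_parameters A C"
  unfolding smooth_surface_def local_parameters_def by blast

lemma smooth_surface_chart:
  assumes "smooth_surface A"
  obtains C where "C \<in> A" "x \<in> fst C" "local_parameters A C"
proof -
  obtain C where "C \<in> A" "x \<in> fst C" using assms unfolding smooth_surface_def by blast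
  then show thesis using that smooth_surface_local_parameters[OF assms] by blast
qed

lemma local_parameters_topological: "local_parameters A C \<Longrightarrow> topological_chart C"
  unfolding local_parameters_def by blast

lemma has_derivative_change_chart:
  assumes "topological_chart C" "topological_chart D" "smooth_transition C D" "y \<in> fst C \<inter> fst D"
    and "((g \<circ> coord_inv D) has_derivative d) (at (snd D y))"
  shows "((g \<circ> coord_inv C) has_derivative (\<lambda>X. d (dif C (snd D) y X))) (at (snd C y))"
proof -
  let ?S = "snd C ` (fst C \<inter> fst D)"
  have o: "open ?S"
    by (rule open_chart_image[OF assms(1)]) (use assms(2) in \<open>simp add: topological_chart_def\<close>)
  have y: "snd C y \<in> ?S" using assms(4) by blast
  have tr: "((snd D \<circ> coord_inv C) has_derivative dif C (snd D) y) (at (snd C y))"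
    unfolding dif_def using assms(3) y
    by (intro smooth_on_has_derivative[of ?S]) (auto simp: smooth_transition_def)
  have e: "(snd D \<circ> coord_inv C) (snd C y) = snd D y"
    using coord_inv_apply[OF assms(1)] assms(4) by simp
  have "((\<lambda>z. (g \<circ> coord_inv D) ((snd D \<circ> coord_inv C) z)) has_derivative
      (\<lambda>X. d (dif C (snd D) y X))) (at (snd C y))"
    by (rule has_derivative_compose[OF tr]) (simp only: e assms(5))
  then show ?thesis
  proof (rule has_derivative_transform_within_open[OF _ o y])
    fix z assume "z \<in> ?S"
    then show "(g \<circ> coord_inv D) ((snd D \<circ> coord_inv C) z) = (g \<circ> coord_inv C) z"
      using coord_inv_apply[OF assms(1)] coord_inv_apply[OF assms(2)] by auto
  qed
qed

text \<open>Smoothness is required in the charts of the atlas only; the transition maps carry it over to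
  any other local parameters.\<close>

lemma smooth_map_on_parameters:
  assumes "smooth_surface A" "local_parameters A C" "open W" "smooth_map_on A W g"
  shows "smooth_on (snd C ` (fst C \<inter> W)) (g \<circ> coord_inv C)"
proof -
  have C: "topological_chart C" by (rule local_parameters_topological[OF assms(2)])
  let ?S = "\<lambda>D. snd C ` (fst C \<inter> (fst D \<inter> W))"
  have "(\<Union>D\<in>A. fst D) = UNIV" using assms(1) by (simp add: smooth_surface_def)
  then have "snd C ` (fst C \<inter> W) = (\<Union>D\<in>A. ?S D)" by blast
  moreover have "smooth_on (\<Union>D\<in>A. ?S D) (g \<circ> coord_inv C)"
  proof (rule smooth_on_UN)
    fix D assume D: "D \<in> A"
    then have tD: "topological_chart D" using assms(1) by (simp add: smooth_surface_def)
    then have oD: "open (fst D \<inter> W)" using assms(3) by (auto simp: topological_chart_def)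
    show o: "open (?S D)" by (rule open_chart_image[OF C oD])
    have "smooth_on (?S D) (\<lambda>z. (g \<circ> coord_inv D) ((snd D \<circ> coord_inv C) z))"
    proof (rule smooth_on_compose[OF o open_chart_image[OF tD assms(3)]])
      show "smooth_on (snd D ` (fst D \<inter> W)) (g \<circ> coord_inv D)"
        using assms(4) D by (simp add: smooth_map_on_def)
      have "smooth_on (snd C ` (fst C \<inter> fst D)) (snd D \<circ> coord_inv C)"
        using assms(2) D by (simp add: local_parameters_def smooth_transition_def)
      then show "smooth_on (?S D) (snd D \<circ> coord_inv C)" by (rule smooth_on_subset) auto
      show "(snd D \<circ> coord_inv C) ` ?S D \<subseteq> snd D ` (fst D \<inter> W)"
        using coord_inv_apply[OF C] by auto
    qed
    then show "smooth_on (?S D) (g \<circ> coord_inv C)"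
      by (rule iffD1[OF smooth_on_cong[OF o], rotated])
        (use coord_inv_apply[OF C] coord_inv_apply[OF tD] in auto)
  qed
  ultimately show ?thesis by simp
qed

lemma smooth_map_on_subset: "smooth_map_on A W g \<Longrightarrow> W' \<subseteq> W \<Longrightarrow> smooth_map_on A W' g"
  unfolding smooth_map_on_def by (meson Int_mono image_mono order_refl smooth_on_subset)

lemma smooth_surface_open_chart_image:
  "smooth_surface A \<Longrightarrow> C \<in> A \<Longrightarrow> open W \<Longrightarrow> open (snd C ` (fst C \<inter> W))"
  unfolding smooth_surface_def by (blast intro: open_chart_image)

lemma smooth_map_on_compose:
  fixes h :: "'b::euclidean_space \<Rightarrow> 'c::real_normed_vector"
  assumes "smooth_surface A" "open W" "open J" "smooth_on J h" "smooth_map_on A W w" "w ` W \<subseteq> J"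
  shows "smooth_map_on A W (\<lambda>y. h (w y))"
  unfolding smooth_map_on_def
proof
  fix C assume C: "C \<in> A"
  then have tC: "topological_chart C" using assms(1) by (simp add: smooth_surface_def)
  have "smooth_on (snd C ` (fst C \<inter> W)) (\<lambda>z. h ((w \<circ> coord_inv C) z))"
  proof (rule smooth_on_compose[OF smooth_surface_open_chart_image[OF assms(1) C assms(2)] assms(3,4)])
    show "smooth_on (snd C ` (fst C \<inter> W)) (w \<circ> coord_inv C)"
      using assms(5) C by (simp add: smooth_map_on_def)
    show "(w \<circ> coord_inv C) ` (snd C ` (fst C \<inter> W)) \<subseteq> J"
      using coord_inv_apply[OF tC] assms(6) by auto
  qed
  then show "smooth_on (snd C ` (fst C \<inter> W)) ((\<lambda>y. h (w y)) \<circ> coord_inv C)"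
    by (simp add: o_def)
qed

lemma smooth_map_on_bilinear:
  assumes "smooth_surface A" "open W" "bounded_bilinear B" "smooth_map_on A W g" "smooth_map_on A W h"
  shows "smooth_map_on A W (\<lambda>y. B (g y) (h y))"
  unfolding smooth_map_on_def
proof
  fix C assume C: "C \<in> A"
  show "smooth_on (snd C ` (fst C \<inter> W)) ((\<lambda>y. B (g y) (h y)) \<circ> coord_inv C)"
    using smooth_on_bilinear[OF smooth_surface_open_chart_image[OF assms(1) C assms(2)] assms(3),
        of "g \<circ> coord_inv C" "h \<circ> coord_inv C"] assms(4,5) C
    by (simp add: smooth_map_on_def o_def)
qed

lemmas smooth_map_on_scaleR = smooth_map_on_bilinear[OF _ _ bounded_bilinear_scaleR]

lemma smooth_map_on_diff:
  assumes "smooth_surface A" "open W" "smooth_map_on A W g" "smooth_map_on A W h"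
  shows "smooth_map_on A W (\<lambda>y. g y - h y)"
  unfolding smooth_map_on_def
proof
  fix C assume C: "C \<in> A"
  show "smooth_on (snd C ` (fst C \<inter> W)) ((\<lambda>y. g y - h y) \<circ> coord_inv C)"
    using smooth_on_diff[OF smooth_surface_open_chart_image[OF assms(1) C assms(2)],
        of "g \<circ> coord_inv C" "h \<circ> coord_inv C"] assms(3,4) C
    by (simp add: smooth_map_on_def o_def)
qed

lemma smooth_map_on_Pair:
  assumes "smooth_surface A" "open W" "smooth_map_on A W g" "smooth_map_on A W h"
  shows "smooth_map_on A W (\<lambda>y. (g y, h y))"
  unfolding smooth_map_on_def
proof
  fix C assume C: "C \<in> A"
  show "smooth_on (snd C ` (fst C \<inter> W)) ((\<lambda>y. (g y, h y)) \<circ> coord_inv C)"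
    using smooth_on_Pair[OF smooth_surface_open_chart_image[OF assms(1) C assms(2)],
        of "g \<circ> coord_inv C" "h \<circ> coord_inv C"] assms(3,4) C
    by (simp add: smooth_map_on_def o_def)
qed

lemma smooth_map_on_continuous_on:
  assumes "smooth_surface A" "open W" "smooth_map_on A W g"
  shows "continuous_on W g"
proof -
  have "continuous_on (\<Union>C\<in>A. fst C \<inter> W) g"
  proof (rule continuous_on_open_UN)
    fix C assume C: "C \<in> A"
    then have tC: "topological_chart C" using assms(1) by (simp add: smooth_surface_def)
    show "open (fst C \<inter> W)" using tC assms(2) by (auto simp: topological_chart_def)
    have "continuous_on (fst C \<inter> W) (\<lambda>y. (g \<circ> coord_inv C) (snd C y))"
    proof (rule continuous_on_compose2[of "snd C ` (fst C \<inter> W)"])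
      show "continuous_on (snd C ` (fst C \<inter> W)) (g \<circ> coord_inv C)"
        using assms(3) C by (intro smooth_on_continuous_on) (simp add: smooth_map_on_def)
      show "continuous_on (fst C \<inter> W) (snd C)"
        using tC continuous_on_subset[OF homeomorphism_cont1,
            of "fst C" "snd C ` fst C" "snd C" "coord_inv C" "fst C \<inter> W"]
        by (simp add: topological_chart_def)
    qed simp
    then show "continuous_on (fst C \<inter> W) g"
      by (rule continuous_on_cong[THEN iffD1, rotated -1]) (auto simp: coord_inv_apply[OF tC])
  qed
  moreover have "(\<Union>C\<in>A. fst C) = UNIV" using assms(1) by (simp add: smooth_surface_def)
  then have "(\<Union>C\<in>A. fst C \<inter> W) = W" by blast
  ultimately show ?thesis by simp
qed

lemma dif_has_derivative:
  assumes "smooth_surface A" "local_parameters A C" "open W" "smooth_map_on A W g" "y \<in> fst C" "y \<in> W"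
  shows "((g \<circ> coord_inv C) has_derivative dif C g y) (at (snd C y))"
  unfolding dif_def using assms(5,6)
  by (intro smooth_on_has_derivative[OF smooth_map_on_parameters[OF assms(1-4)]]) auto

lemma dif_eqI: "((g \<circ> coord_inv C) has_derivative d) (at (snd C y)) \<Longrightarrow> dif C g y = d"
  unfolding dif_def by (rule frechet_derivative_at[symmetric])

lemma inv_into_homeomorphism:
  assumes "homeomorphism S T f g" "y \<in> T"
  shows "inv_into S f y = g y"
proof -
  have "inj_on f S" using assms(1) by (metis homeomorphism_apply1 inj_onI)
  moreover have "g y \<in> S" "f (g y) = y" using assms homeomorphism_apply2 homeomorphism_image2 by (metis image_eqI, metis)
  ultimately show ?thesis using inv_into_f_eq by metis
qed

text \<open>A smooth map to the plane whose differential at a point is injective serves as a chart near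
  that point: its coordinate expression has a smooth local inverse.\<close>

lemma local_parametersI:
  fixes \<phi> :: "'m::topological_space \<Rightarrow> real \<times> real"
  assumes A: "smooth_surface A" and W: "open W" "smooth_map_on A W \<phi>" "x \<in> W"
    and C0: "C0 \<in> A" "x \<in> fst C0" "inj (dif C0 \<phi> x)"
  obtains C where "local_parameters A C" "x \<in> fst C" "fst C \<subseteq> W" "snd C = \<phi>"
proof -
  have tC0: "topological_chart C0" using A C0(1) by (simp add: smooth_surface_def)
  then have h0: "homeomorphism (fst C0) (snd C0 ` fst C0) (snd C0) (coord_inv C0)"
    by (simp add: topological_chart_def)
  define U where "U = snd C0 ` (fst C0 \<inter> W)"
  define \<psi> where "\<psi> = \<phi> \<circ> coord_inv C0"
  have U: "open U" unfolding U_def by (rule open_chart_image[OF tC0 W(1)])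
  have \<psi>: "smooth_on U \<psi>" using W(2) C0(1) by (simp add: smooth_map_on_def U_def \<psi>_def)
  have x: "snd C0 x \<in> U" using C0(2) W(3) by (simp add: U_def)
  have "inj (frechet_derivative \<psi> (at (snd C0 x)))"
    using C0(3) by (simp add: dif_def \<psi>_def)
  then obtain U' V \<theta> where U': "open U'" "U' \<subseteq> U" "snd C0 x \<in> U'" and V: "open V"
    and hom: "homeomorphism U' V \<psi> \<theta>" and \<theta>: "smooth_on V \<theta>"
    using inverse_function_plane[OF U \<psi> x] by blast
  define S where "S = coord_inv C0 ` U'"
  define C where "C = (S, \<phi>)"
  have S: "S \<subseteq> fst C0 \<inter> W"
    using U'(2) coord_inv_apply[OF tC0] by (auto simp: S_def U_def)
  have S_eq: "snd C0 ` S = U'"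
  proof -
    have "snd C0 (coord_inv C0 z) = z" if "z \<in> U'" for z
      using that U'(2) coord_inv_apply[OF tC0] by (auto simp: U_def)
    then show ?thesis by (simp add: S_def image_image)
  qed
  have hS: "homeomorphism S U' (snd C0) (coord_inv C0)"
    by (rule homeomorphism_of_subsets[OF h0]) (use S S_eq U'(2) in \<open>auto simp: U_def\<close>)
  have hC: "homeomorphism S V \<phi> (coord_inv C0 \<circ> \<theta>)"
    by (rule homeomorphism_cong[OF homeomorphism_compose[OF hS hom]])
      (use S coord_inv_apply[OF tC0] in \<open>auto simp: \<psi>_def\<close>)
  have inv: "coord_inv C z = coord_inv C0 (\<theta> z)" if "z \<in> V" for z
    using inv_into_homeomorphism[OF hC that] by (simp add: coord_inv_def C_def)
  have V_eq: "\<phi> ` S = V" using hC by (simp add: homeomorphism_def)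
  have "openin (top_of_set (fst C0)) S"
    unfolding S_def using U'(1,2) h0
    by (intro homeomorphism_imp_open_map[OF homeomorphism_symD[OF h0]]) (auto simp: U_def openin_open)
  then have oS: "open S"
    using tC0 openin_open_trans by (auto simp: topological_chart_def)
  have "homeomorphism S V \<phi> (coord_inv C)"
    by (rule homeomorphism_cong[OF hC]) (simp_all add: inv)
  then have tC: "topological_chart C"
    unfolding topological_chart_def using oS V V_eq by (simp add: C_def)
  have "local_parameters A C"
    unfolding local_parameters_def
  proof (intro conjI ballI tC)
    fix D assume D: "D \<in> A"
    then have tD: "topological_chart D" using A by (simp add: smooth_surface_def)
    then have oD: "open (fst D)" by (simp add: topological_chart_def)
    let ?T = "snd C ` (fst C \<inter> fst D)"
    have oT: "open ?T" by (rule open_chart_image[OF tC oD])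
    have TV: "?T \<subseteq> V" using V_eq by (auto simp: C_def)
    have "smooth_on ?T (\<lambda>z. (snd D \<circ> coord_inv C0) (\<theta> z))"
    proof (rule smooth_on_compose[OF oT open_chart_image[OF tC0 oD], of "snd D \<circ> coord_inv C0" \<theta>])
      show "smooth_on (snd C0 ` (fst C0 \<inter> fst D)) (snd D \<circ> coord_inv C0)"
        using A C0(1) D by (simp add: smooth_surface_def smooth_transition_def)
      show "smooth_on ?T \<theta>" by (rule smooth_on_subset[OF \<theta> TV])
      show "\<theta> ` ?T \<subseteq> snd C0 ` (fst C0 \<inter> fst D)"
      proof
        fix z assume "z \<in> \<theta> ` ?T"
        then obtain y where y: "y \<in> S" "y \<in> fst D" "z = \<theta> (\<phi> y)" by (auto simp: C_def)
        then have "z = snd C0 y"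
          using homeomorphism_apply1[OF hom, of "snd C0 y"] S S_eq coord_inv_apply[OF tC0]
          by (auto simp: \<psi>_def)
        then show "z \<in> snd C0 ` (fst C0 \<inter> fst D)" using y S by auto
      qed
    qed
    then show "smooth_transition C D"
      unfolding smooth_transition_def
      by (rule iffD1[OF smooth_on_cong[OF oT], rotated]) (metis inv TV subsetD comp_apply)
    have "smooth_on (snd D ` (fst D \<inter> W)) (\<phi> \<circ> coord_inv D)"
      using W(2) D by (simp add: smooth_map_on_def)
    then have "smooth_on (snd D ` (fst D \<inter> S)) (\<phi> \<circ> coord_inv D)"
      by (rule smooth_on_subset) (use S in auto)
    then show "smooth_transition D C"
      by (simp add: smooth_transition_def C_def)
  qed
  moreover have "x \<in> S"
    unfolding S_def using U'(3) coord_inv_apply[OF tC0 C0(2)] by (metis image_eqI)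
  ultimately show thesis using that[of C] S by (simp add: C_def)
qed

section \<open>Differentials in different charts\<close>

lemma coord_inv_image:
  assumes "topological_chart C" "z \<in> snd C ` fst C"
  shows "coord_inv C z \<in> fst C" "snd C (coord_inv C z) = z"
  using assms coord_inv_apply[OF assms(1)] by auto

lemma dif_cong:
  assumes "topological_chart C" "open W" "\<And>y. y \<in> W \<Longrightarrow> g y = h y" "y \<in> fst C" "y \<in> W"
  shows "dif C g y = dif C h y"
  unfolding dif_def
proof (rule frechet_derivative_open_cong[OF open_chart_image[OF assms(1,2)]])
  show "(g \<circ> coord_inv C) z = (h \<circ> coord_inv C) z" if "z \<in> snd C ` (fst C \<inter> W)" for z
    using that coord_inv_apply[OF assms(1)] assms(3) by auto
qed (use assms in auto)

lemma has_dif_own_coordinates: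
  assumes "topological_chart C" "y \<in> fst C"
  shows "((snd C \<circ> coord_inv C) has_derivative (\<lambda>X. X)) (at (snd C y))"
proof (rule has_derivative_transform_within_open[OF has_derivative_ident])
  show "open (snd C ` fst C)" using assms(1) by (simp add: topological_chart_def)
  show "z = (snd C \<circ> coord_inv C) z" if "z \<in> snd C ` fst C" for z
    using coord_inv_image[OF assms(1) that] by simp
qed (use assms(2) in simp)

lemma dif_transition_inverse:
  assumes "topological_chart C" "topological_chart D" "smooth_transition C D" "smooth_transition D C"
    and "y \<in> fst C \<inter> fst D"
  shows "dif D (snd C) y (dif C (snd D) y X) = X"
proof -
  have "snd D y \<in> snd D ` (fst D \<inter> fst C)" using assms(5) by blast
  then have "((snd C \<circ> coord_inv D) has_derivative dif D (snd C) y) (at (snd D y))"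
    unfolding dif_def using assms(4) smooth_on_has_derivative by (auto simp: smooth_transition_def)
  then have "((snd C \<circ> coord_inv C) has_derivative (\<lambda>X. dif D (snd C) y (dif C (snd D) y X))) (at (snd C y))"
    by (rule has_derivative_change_chart[OF assms(1-3,5)])
  from has_derivative_unique[OF this has_dif_own_coordinates[OF assms(1)]] assms(5) show ?thesis
    by (auto dest: fun_cong)
qed

lemma dif_change_chart:
  assumes "smooth_surface A" "local_parameters A C" "D \<in> A" "y \<in> fst C \<inter> fst D"
    and "open W" "y \<in> W" "smooth_map_on A W g"
  shows "dif C g y X = dif D g y (dif C (snd D) y X)"
    and "dif D g y X = dif C g y (dif D (snd C) y X)"
proof -
  have C: "topological_chart C" "smooth_transition C D" "smooth_transition D C"
    using assms(2,3) by (auto simp: local_parameters_def)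
  have D: "topological_chart D" "local_parameters A D"
    using smooth_surface_local_parameters[OF assms(1,3)] local_parameters_topological by blast+
  have "dif C g y = (\<lambda>X. dif D g y (dif C (snd D) y X))"
    using assms by (intro dif_eqI has_derivative_change_chart[OF C(1) D(1) C(2) assms(4)]
        dif_has_derivative[OF assms(1) D(2)]) auto
  then show "dif C g y X = dif D g y (dif C (snd D) y X)" by simp
  have "dif D g y = (\<lambda>X. dif C g y (dif D (snd C) y X))"
    using assms by (intro dif_eqI has_derivative_change_chart[OF D(1) C(1) C(3)]
        dif_has_derivative[OF assms(1,2)]) auto
  then show "dif D g y X = dif C g y (dif D (snd C) y X)" by simp
qed

lemma has_dif_curve:
  assumes "((w \<circ> coord_inv C) has_derivative d) (at (snd C y))" "coord_inv C (snd C y) = y"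
    and "(h has_vector_derivative h') (at (w y))"
  shows "(((\<lambda>y. h (w y)) \<circ> coord_inv C) has_derivative (\<lambda>X. d X *\<^sub>R h')) (at (snd C y))"
proof -
  have h: "(h has_derivative (\<lambda>x. x *\<^sub>R h')) (at ((w \<circ> coord_inv C) (snd C y)))"
    using assms(2,3) by (simp add: has_vector_derivative_def)
  show ?thesis using has_derivative_compose[OF assms(1) h] by (simp add: o_def)
qed

lemma has_dif_scaleR:
  assumes "((l \<circ> coord_inv C) has_derivative dl) (at (snd C y))" "coord_inv C (snd C y) = y"
    and "((g \<circ> coord_inv C) has_derivative dg) (at (snd C y))"
  shows "(((\<lambda>y. l y *\<^sub>R g y) \<circ> coord_inv C) has_derivative (\<lambda>X. l y *\<^sub>R dg X + dl X *\<^sub>R g y)) (at (snd C y))"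
  using has_derivative_scaleR[OF assms(1,3)] assms(2) by (simp add: o_def)

lemma has_dif_add:
  assumes "((g \<circ> coord_inv C) has_derivative dg) (at (snd C y))"
    and "((h \<circ> coord_inv C) has_derivative dh) (at (snd C y))"
  shows "(((\<lambda>y. g y + h y) \<circ> coord_inv C) has_derivative (\<lambda>X. dg X + dh X)) (at (snd C y))"
  using has_derivative_add[OF assms] by (simp add: o_def)

lemma has_dif_diff:
  assumes "((g \<circ> coord_inv C) has_derivative dg) (at (snd C y))"
    and "((h \<circ> coord_inv C) has_derivative dh) (at (snd C y))"
  shows "(((\<lambda>y. g y - h y) \<circ> coord_inv C) has_derivative (\<lambda>X. dg X - dh X)) (at (snd C y))"
  using has_derivative_diff[OF assms] by (simp add: o_def)


section \<open>Principal curvatures\<close>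

lemma lie_inner_left:
  "lie_inner (x + y) z = lie_inner x z + lie_inner y z"
  "lie_inner (r *\<^sub>R x) z = r * lie_inner x z"
  by (simp_all add: lie_inner_def algebra_simps)

lemma bounded_linear_lie_inner_left: "bounded_linear (\<lambda>x. lie_inner x z)"
  unfolding linear_conv_bounded_linear[symmetric]
  by (rule linearI) (simp_all add: lie_inner_left)

locale surface_with_tangent_planes =
  fixes A :: "'m::topological_space chart set" and p q :: "real^6" and f t :: "'m \<Rightarrow> real^6"
  assumes surface: "smooth_surface A"
    and immersed: "immersed_surface A p q f"
    and tangent_planes: "tangent_plane_congruence A p q f t"
begin

lemma smooth_f: "smooth_map_on A W f" and smooth_t: "smooth_map_on A W t"
  using immersed tangent_planes smooth_map_on_subset[OF _ subset_UNIV]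
  by (auto simp: immersed_surface_def tangent_plane_congruence_def)

lemma lie_inner_f: "lie_inner (f x) p = 0" "lie_inner (f x) q = -1"
  using immersed by (auto simp: immersed_surface_def space_form_def)

lemma lie_inner_t: "lie_inner (t x) p = -1" "lie_inner (t x) q = 0"
  using tangent_planes by (auto simp: tangent_plane_congruence_def space_form_planes_def)

lemmas has_dif = dif_has_derivative[OF surface]
lemmas has_dif_f = dif_has_derivative[OF surface _ open_UNIV smooth_f _ UNIV_I]
lemmas has_dif_t = dif_has_derivative[OF surface _ open_UNIV smooth_t _ UNIV_I]

lemma inj_dif_f:
  assumes C: "local_parameters A C" and y: "y \<in> fst C"
  shows "inj (dif C f y)"
proof -
  obtain D where D: "D \<in> A" "y \<in> fst D" "local_parameters A D"
    using smooth_surface_chart[OF surface] by blast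
  have "dif C f y = dif D f y \<circ> dif C (snd D) y"
    using dif_change_chart(1)[OF surface C D(1) _ open_UNIV UNIV_I smooth_f] y D(2) by auto
  moreover have "inj (dif D f y)" using immersed D by (simp add: immersed_surface_def)
  moreover have "dif D (snd C) y (dif C (snd D) y X) = X" for X
    using C D y by (intro dif_transition_inverse) (auto simp: local_parameters_def)
  then have "inj (dif C (snd D) y)" by (metis injI)
  ultimately show ?thesis by (simp add: inj_compose)
qed

text \<open>The definition refers to charts of the atlas. The coordinates adapted to a channel surface
  are not among these, so Rodrigues' equation is carried over to arbitrary local parameters.\<close>

lemma principal_curvatures_iff:
  assumes C: "local_parameters A C" and y: "y \<in> fst C"
  shows "k \<in> principal_curvatures A f t y \<longleftrightarrow> (\<exists>X. X \<noteq> 0 \<and> dif C t y X + k *\<^sub>R dif C f y X = 0)"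
proof
  assume "k \<in> principal_curvatures A f t y"
  then obtain D X where D: "D \<in> A" "y \<in> fst D" and X: "X \<noteq> 0" "dif D t y X + k *\<^sub>R dif D f y X = 0"
    by (auto simp: principal_curvatures_def)
  have LD: "local_parameters A D" using smooth_surface_local_parameters[OF surface D(1)] .
  have "dif C (snd D) y (dif D (snd C) y X) = X"
    using C LD D y by (intro dif_transition_inverse) (auto simp: local_parameters_def)
  moreover have "dif C (snd D) y 0 = 0"
  proof -
    have "((snd D \<circ> coord_inv C) has_derivative dif C (snd D) y) (at (snd C y))"
      unfolding dif_def using C D y
      by (intro smooth_on_has_derivative[of "snd C ` (fst C \<inter> fst D)"])
        (auto simp: local_parameters_def smooth_transition_def)
    then show ?thesis using has_derivative_linear linear_0 by blast
  qed
  ultimately have "dif D (snd C) y X \<noteq> 0" using X(1) by metis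
  moreover have "dif C t y (dif D (snd C) y X) + k *\<^sub>R dif C f y (dif D (snd C) y X) = 0"
    using X(2) dif_change_chart(2)[OF surface C D(1) _ open_UNIV UNIV_I smooth_f, of y]
      dif_change_chart(2)[OF surface C D(1) _ open_UNIV UNIV_I smooth_t, of y] y D(2) by simp
  ultimately show "\<exists>X. X \<noteq> 0 \<and> dif C t y X + k *\<^sub>R dif C f y X = 0" by blast
next
  assume "\<exists>X. X \<noteq> 0 \<and> dif C t y X + k *\<^sub>R dif C f y X = 0"
  then obtain X where X: "X \<noteq> 0" "dif C t y X + k *\<^sub>R dif C f y X = 0" by blast
  obtain D where D: "D \<in> A" "y \<in> fst D" "local_parameters A D"
    using smooth_surface_chart[OF surface] by blast
  have e: "dif C f y X = dif D f y (dif C (snd D) y X)" "dif C t y X = dif D t y (dif C (snd D) y X)"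
    using dif_change_chart(1)[OF surface C D(1) _ open_UNIV UNIV_I smooth_f, of y]
      dif_change_chart(1)[OF surface C D(1) _ open_UNIV UNIV_I smooth_t, of y] y D(2) by simp_all
  have "dif C (snd D) y X \<noteq> 0"
  proof
    assume "dif C (snd D) y X = 0"
    then have "dif C f y X = 0"
      using e(1) linear_0[OF has_derivative_linear[OF has_dif_f[OF D(3,2)]]] by simp
    then show False
      using X(1) inj_dif_f[OF C y] linear_injective_0[OF has_derivative_linear[OF has_dif_f[OF C y]]]
      by blast
  qed
  then show "k \<in> principal_curvatures A f t y"
    using X(2) D(1,2) unfolding e principal_curvatures_def by blast
qed

text \<open>Because \<open>df\<close> is injective, the pencil \<open>dt + k df\<close> has at most two eigenvalues. If one of
  them is known, the absence of umbilics yields the other, and both curvature functions are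
  symmetric in the two.\<close>

lemma principal_curvatures_two:
  assumes "k \<in> principal_curvatures A f t y" "curv1 A f t y \<noteq> curv2 A f t y"
  obtains l where "l \<noteq> k" "l \<in> principal_curvatures A f t y"
    "gauss_curvature A f t y = k * l" "2 * mean_curvature A f t y = k + l"
proof -
  let ?E = "principal_curvatures A f t y"
  obtain C where C: "local_parameters A C" "y \<in> fst C"
    using smooth_surface_chart[OF surface] by blast
  have "\<exists>l\<in>?E. l \<noteq> k"
  proof (rule ccontr)
    assume "\<not> (\<exists>l\<in>?E. l \<noteq> k)"
    then have "?E = {k}" using assms(1) by blast
    then show False using assms(2) by (simp add: curv1_def curv2_def)
  qed
  then obtain l where l: "l \<in> ?E" "l \<noteq> k" by blast
  obtain X Y where XY: "X \<noteq> 0" "dif C t y X + k *\<^sub>R dif C f y X = 0"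
    "Y \<noteq> 0" "dif C t y Y + l *\<^sub>R dif C f y Y = 0"
    using assms(1) l(1) unfolding principal_curvatures_iff[OF C] by blast
  have "m = k \<or> m = l" if m: "m \<in> ?E" for m
  proof -
    obtain Z where "Z \<noteq> 0" "dif C t y Z + m *\<^sub>R dif C f y Z = 0"
      using m unfolding principal_curvatures_iff[OF C] by blast
    then show ?thesis
      using pencil_eigenvalues_two[OF has_derivative_linear[OF has_dif_f[OF C]]
          has_derivative_linear[OF has_dif_t[OF C]] inj_dif_f[OF C]] XY l(2) by blast
  qed
  then have "?E = {k, l}" using assms(1) l(1) by blast
  then show thesis
    using l by (intro that[of l])
      (auto simp: curv1_def curv2_def gauss_curvature_def mean_curvature_def max_def min_def)
qed

end

section \<open>The enveloped spheres of a channel surface\<close>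

lemma span_scaleR_singleton:
  assumes "c \<noteq> 0"
  shows "span {c *\<^sub>R v} = span {v}"
proof -
  have "c *\<^sub>R v \<in> span {v}" by (simp add: span_base span_scale)
  moreover have "inverse c *\<^sub>R (c *\<^sub>R v) \<in> span {c *\<^sub>R v}" by (intro span_scale span_base) simp
  then have "v \<in> span {c *\<^sub>R v}" using assms by simp
  ultimately show ?thesis by (simp add: span_eq)
qed

context surface_with_tangent_planes
begin

text \<open>By the normalisation of \<open>f\<close> and \<open>t\<close>, the inner products with \<open>q\<close> and \<open>p\<close> read off the
  coefficients of a vector in their span.\<close>

lemma enveloped_sphere_decomposition:
  assumes "envelops (legendre_lift f t) \<sigma>" "\<sigma> y = span {v}"
  shows "v = - lie_inner v q *\<^sub>R f y - lie_inner v p *\<^sub>R t y" "v \<noteq> 0"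
proof -
  have s: "\<sigma> y \<in> lie_quadric" "\<sigma> y \<subseteq> span {f y, t y}"
    using assms(1) unfolding envelops_def legendre_lift_def by blast+
  show "v \<noteq> 0"
  proof
    assume "v = 0"
    then have 0: "\<sigma> y = {0}" using assms(2) by simp
    obtain u where u: "u \<noteq> 0" "\<sigma> y = span {u}" using s(1) unfolding lie_quadric_def by blast
    have "u \<in> \<sigma> y" unfolding u(2) by (simp add: span_base)
    then show False using u(1) unfolding 0 by simp
  qed
  have "v \<in> \<sigma> y" unfolding assms(2) by (simp add: span_base)
  then have "v \<in> span {f y, t y}" using s(2) by blast
  then obtain k where "v - k *\<^sub>R f y \<in> span {t y}" using span_breakdown_eq by metis
  then obtain l where "v - k *\<^sub>R f y = l *\<^sub>R t y" by (auto simp: span_singleton)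
  then have v: "v = k *\<^sub>R f y + l *\<^sub>R t y" by (simp add: algebra_simps)
  have "lie_inner v q = - k" "lie_inner v p = - l"
    unfolding v by (simp_all add: lie_inner_left lie_inner_f lie_inner_t)
  then have "- lie_inner v q *\<^sub>R f y - lie_inner v p *\<^sub>R t y = k *\<^sub>R f y + l *\<^sub>R t y"
    by simp
  from trans[OF v this[symmetric]] show "v = - lie_inner v q *\<^sub>R f y - lie_inner v p *\<^sub>R t y" .
qed

text \<open>At a point \<open>y\<close> pick a direction \<open>X\<close> in which the parameter \<open>w\<close> of the sphere curve is
  stationary. Along \<open>X\<close> the coefficients of \<open>\<gamma>(w)\<close> in \<open>f\<close> and \<open>t\<close> are stationary too, and what remains
  of the differentiated decomposition is Rodrigues' equation. The coefficient of \<open>t\<close> is non-zero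
  because otherwise \<open>df(X) = 0\<close>.\<close>

lemma channel_curvature:
  fixes w :: "'m \<Rightarrow> real"
  assumes env: "envelops (legendre_lift f t) \<sigma>"
    and W: "open W" "smooth_map_on A W w" and J: "open J" "w ` W \<subseteq> J" "smooth_on J \<gamma>"
    and \<sigma>: "\<And>y. y \<in> W \<Longrightarrow> \<sigma> y = span {\<gamma> (w y)}" and y: "y \<in> W"
  shows "lie_inner (\<gamma> (w y)) p \<noteq> 0"
    and "lie_inner (\<gamma> (w y)) q / lie_inner (\<gamma> (w y)) p \<in> principal_curvatures A f t y"
proof -
  obtain C where C: "local_parameters A C" "y \<in> fst C"
    using smooth_surface_chart[OF surface] by blast
  have tC: "topological_chart C" by (rule local_parameters_topological[OF C(1)])
  note cy = coord_inv_apply[OF tC C(2)]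
  have dw: "((w \<circ> coord_inv C) has_derivative dif C w y) (at (snd C y))"
    by (rule has_dif[OF C(1) W C(2) y])
  obtain X where X: "X \<noteq> 0" "dif C w y X = 0"
    using linear_plane_kernel[OF has_derivative_linear[OF dw]] by blast
  define \<gamma>' where "\<gamma>' = frechet_derivative \<gamma> (at (w y)) 1"
  have d\<gamma>: "(\<gamma> has_vector_derivative \<gamma>') (at (w y))"
    unfolding \<gamma>'_def using J y by (intro smooth_on_has_vector_derivative[OF J(3)]) auto
  have dl: "((\<lambda>r. - lie_inner (\<gamma> r) z) has_vector_derivative - lie_inner \<gamma>' z) (at (w y))" for z
    by (intro has_vector_derivative_minus
        bounded_linear.has_vector_derivative[OF bounded_linear_lie_inner_left d\<gamma>])
  let ?\<alpha> = "\<lambda>z y. - lie_inner (\<gamma> (w y)) z"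
  have g1: "dif C (\<lambda>y. \<gamma> (w y)) y = dif C (\<lambda>y. ?\<alpha> q y *\<^sub>R f y + ?\<alpha> p y *\<^sub>R t y) y"
    using enveloped_sphere_decomposition(1)[OF env \<sigma>]
    by (intro dif_cong[OF tC W(1) _ C(2) y]) simp
  have g2: "dif C (\<lambda>y. \<gamma> (w y)) y X = dif C w y X *\<^sub>R \<gamma>'"
    by (rule fun_cong[OF dif_eqI[OF has_dif_curve[OF dw cy d\<gamma>]]])
  have g3: "dif C (\<lambda>y. ?\<alpha> q y *\<^sub>R f y + ?\<alpha> p y *\<^sub>R t y) y X =
      (?\<alpha> q y *\<^sub>R dif C f y X + (dif C w y X *\<^sub>R - lie_inner \<gamma>' q) *\<^sub>R f y) +
        (?\<alpha> p y *\<^sub>R dif C t y X + (dif C w y X *\<^sub>R - lie_inner \<gamma>' p) *\<^sub>R t y)"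
    by (rule fun_cong[OF dif_eqI[OF has_dif_add[OF
            has_dif_scaleR[OF has_dif_curve[OF dw cy dl] cy has_dif_f[OF C]]
            has_dif_scaleR[OF has_dif_curve[OF dw cy dl] cy has_dif_t[OF C]]]]])
  have "0 = ?\<alpha> q y *\<^sub>R dif C f y X + ?\<alpha> p y *\<^sub>R dif C t y X"
    using g2 g3 unfolding g1 X(2) by simp
  then have eq: "lie_inner (\<gamma> (w y)) q *\<^sub>R dif C f y X + lie_inner (\<gamma> (w y)) p *\<^sub>R dif C t y X = 0"
    by (simp add: algebra_simps)
  have dfX: "dif C f y X \<noteq> 0"
    using X(1) inj_dif_f[OF C] linear_injective_0[OF has_derivative_linear[OF has_dif_f[OF C]]] by blast
  show p0: "lie_inner (\<gamma> (w y)) p \<noteq> 0"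
  proof
    assume p: "lie_inner (\<gamma> (w y)) p = 0"
    then have "lie_inner (\<gamma> (w y)) q = 0" using eq dfX by simp
    then show False using p enveloped_sphere_decomposition[OF env \<sigma>[OF y]] by simp
  qed
  have "lie_inner (\<gamma> (w y)) p *\<^sub>R
      (dif C t y X + (lie_inner (\<gamma> (w y)) q / lie_inner (\<gamma> (w y)) p) *\<^sub>R dif C f y X) = 0"
    using eq p0 by (simp add: scaleR_add_right add.commute)
  then show "lie_inner (\<gamma> (w y)) q / lie_inner (\<gamma> (w y)) p \<in> principal_curvatures A f t y"
    using p0 X(1) unfolding principal_curvatures_iff[OF C] scaleR_eq_0_iff by blast
qed

text \<open>The inner product with \<open>q\<close> vanishes on \<open>t\<close>, whereas on \<open>g = t + k f\<close> it is \<open>- k\<close>.\<close>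

lemma span_tangent_plane_iff:
  assumes "t y = g - k *\<^sub>R f y"
  shows "span {t y} = span {g} \<longleftrightarrow> k = 0"
proof
  assume "span {t y} = span {g}"
  moreover have "g \<in> span {g}" by (simp add: span_base)
  ultimately have "g \<in> span {t y}" by simp
  then obtain c where c: "g = c *\<^sub>R t y" by (auto simp: span_singleton)
  have "g = t y + k *\<^sub>R f y" using assms by simp
  then have "lie_inner g q = - k" by (simp only: lie_inner_left lie_inner_f lie_inner_t)
  moreover have "lie_inner g q = 0" by (simp only: c lie_inner_left lie_inner_t)
  ultimately show "k = 0" by simp
qed (use assms in simp)

text \<open>The local data of a channel linear Weingarten surface: both principal curvatures are smooth
  functions \<open>k\<close>, \<open>l\<close> of the parameter \<open>w\<close> of the enveloped family, and \<open>g\<close> is the family itself,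
  scaled to inner product \<open>-1\<close> with \<open>p\<close>. For \<open>k(w)\<close>, Rodrigues' equation is
  contained in the equation for \<open>t\<close>: differentiate it in a direction in the kernel of \<open>dw\<close>.\<close>

definition channel_data ::
  "'m set \<Rightarrow> ('m \<Rightarrow> real) \<Rightarrow> real set \<Rightarrow> (real \<Rightarrow> real) \<Rightarrow> (real \<Rightarrow> real) \<Rightarrow> (real \<Rightarrow> real^6) \<Rightarrow> bool" where
  "channel_data W w I k l g \<longleftrightarrow> open W \<and> smooth_map_on A W w \<and> open I \<and> w ` W \<subseteq> I \<and>
     smooth_on I k \<and> smooth_on I l \<and> smooth_on I g \<and> (\<forall>r\<in>I. k r \<noteq> l r) \<and>
     (\<forall>y\<in>W. t y = g (w y) - k (w y) *\<^sub>R f y \<and> l (w y) \<in> principal_curvatures A f t y)"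

lemma channel_data_subset:
  assumes "channel_data W w I k l g" "open W'" "W' \<subseteq> W" "open I'" "I' \<subseteq> I" "w ` W' \<subseteq> I'"
  shows "channel_data W' w I' k l g"
proof -
  note data = assms(1)[unfolded channel_data_def]
  show ?thesis
    unfolding channel_data_def
  proof (intro conjI ballI)
    show "smooth_map_on A W' w" using data smooth_map_on_subset[OF _ assms(3)] by blast
    show "smooth_on I' k" "smooth_on I' l" "smooth_on I' g"
      using data smooth_on_subset[OF _ assms(5)] by blast+
  qed (use data assms(2-6) in auto)
qed

text \<open>The Weingarten equation reads \<open>(a k + b) l = - (b k + c)\<close>. A zero of \<open>a k + b\<close> would be a zero
  of \<open>b k + c\<close> too, which makes \<open>(k, 1)\<close> a kernel vector of the symmetric matrix with entries
  \<open>a\<close>, \<open>b\<close>, \<open>c\<close>, whose determinant \<open>a c - b\<^sup>2\<close> is non-zero for a non-tubular surface. So \<open>l\<close> is a smooth function of \<open>k\<close>. The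
  denominators and \<open>k - l\<close> are non-zero on the values of \<open>w\<close>, hence on a neighbourhood \<open>I\<close> of
  these values.\<close>

lemma channel_linear_weingarten_data:
  assumes env: "envelops (legendre_lift f t) \<sigma>" and one: "one_parameter_family A \<sigma>"
    and umb: "umbilic_free A f t" and lw: "linear_weingarten A f t a b c" and tub: "\<not> tubular a b c"
  obtains W w I k l g where "x \<in> W" "channel_data W w I k l g"
    "\<forall>y\<in>W. \<sigma> y = span {g (w y)}"
proof -
  obtain W J and w :: "'m \<Rightarrow> real" and \<gamma> where W: "open W" "x \<in> W" "smooth_map_on A W w"
    and J: "open J" "w ` W \<subseteq> J" "smooth_on J \<gamma>"
    and "\<forall>y\<in>W. \<sigma> y = span {\<gamma> (w y)}"
    using one[unfolded one_parameter_family_def, THEN spec, of x] by (elim exE conjE) (rule that)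
  then have \<sigma>: "\<And>y. y \<in> W \<Longrightarrow> \<sigma> y = span {\<gamma> (w y)}" by blast
  define P where "P r = lie_inner (\<gamma> r) p" for r
  define k where "k r = lie_inner (\<gamma> r) q / P r" for r
  define l where "l r = - (b * k r + c) / (a * k r + b)" for r
  define g where "g r = (- 1 / P r) *\<^sub>R \<gamma> r" for r
  have sP: "smooth_on J P" "smooth_on J (\<lambda>r. lie_inner (\<gamma> r) q)"
    unfolding P_def[abs_def]
    by (auto intro: smooth_on_linear_compose[OF J(1) bounded_linear_lie_inner_left J(3)])
  define J1 where "J1 = J \<inter> P -` (- {0})"
  have J1: "open J1" unfolding J1_def
    by (rule continuous_open_preimage[OF smooth_on_continuous_on[OF sP(1)] J(1)]) auto
  have J1J: "J1 \<subseteq> J" and P0: "\<And>r. r \<in> J1 \<Longrightarrow> P r \<noteq> 0" by (auto simp: J1_def)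
  have sk: "smooth_on J1 k"
    unfolding k_def[abs_def] using smooth_on_subset[OF _ J1J] sP P0 by (intro smooth_on_divide J1) auto
  have sN: "smooth_on J1 (\<lambda>r. a * k r + b)" "smooth_on J1 (\<lambda>r. - (b * k r + c))"
    by (intro smooth_on_add smooth_on_mult smooth_on_uminus smooth_on_const sk J1)+
  define J2 where "J2 = J1 \<inter> (\<lambda>r. a * k r + b) -` (- {0})"
  have J2: "open J2" unfolding J2_def
    by (rule continuous_open_preimage[OF smooth_on_continuous_on[OF sN(1)] J1]) auto
  have J21: "J2 \<subseteq> J1" and N0: "\<And>r. r \<in> J2 \<Longrightarrow> a * k r + b \<noteq> 0" by (auto simp: J2_def)
  have sl: "smooth_on J2 l"
    unfolding l_def[abs_def] using smooth_on_subset[OF _ J21] sN N0 by (intro smooth_on_divide J2) auto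
  define I where "I = J2 \<inter> (\<lambda>r. k r - l r) -` (- {0})"
  have I: "open I" unfolding I_def
    by (rule continuous_open_preimage[OF continuous_on_diff[OF smooth_on_continuous_on
            smooth_on_continuous_on] J2]) (use smooth_on_subset[OF sk J21] sl in auto)
  have IJ2: "I \<subseteq> J2" and kl: "\<And>r. r \<in> I \<Longrightarrow> k r \<noteq> l r" by (auto simp: I_def)
  have sg: "smooth_on J1 g"
    unfolding g_def[abs_def] using smooth_on_subset[OF sP(1) J1J] smooth_on_subset[OF J(3) J1J] P0
    by (intro smooth_on_scaleR smooth_on_divide smooth_on_const J1) auto
  have y: "w y \<in> I \<and> \<sigma> y = span {g (w y)} \<and> t y = g (w y) - k (w y) *\<^sub>R f y \<and>
      l (w y) \<in> principal_curvatures A f t y" if y: "y \<in> W" for y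
  proof -
    have Py: "P (w y) \<noteq> 0" and ky: "k (w y) \<in> principal_curvatures A f t y"
      using channel_curvature[OF env W(1,3) J \<sigma> y] by (auto simp: P_def k_def)
    then have y1: "w y \<in> J1" using J(2) y by (auto simp: J1_def)
    obtain m where m: "m \<noteq> k (w y)" "m \<in> principal_curvatures A f t y"
      and KH: "gauss_curvature A f t y = k (w y) * m" "2 * mean_curvature A f t y = k (w y) + m"
      using principal_curvatures_two[OF ky] umb unfolding umbilic_free_def by metis
    have "a * gauss_curvature A f t y + b * (2 * mean_curvature A f t y) + c = 0"
      using lw by (simp add: linear_weingarten_def mult.assoc mult.left_commute)
    then have e: "(a * k (w y) + b) * m = - (b * k (w y) + c)"
      unfolding KH by (simp add: algebra_simps)
    have N: "a * k (w y) + b \<noteq> 0"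
    proof
      assume N: "a * k (w y) + b = 0"
      then have bk: "b * k (w y) + c = 0" using e by simp
      have "a * c - b\<^sup>2 = a * (b * k (w y) + c) - b * (a * k (w y) + b)"
        by (simp add: algebra_simps power2_eq_square)
      then have "a * c - b\<^sup>2 = 0" using N bk by simp
      then show False using tub by (simp add: tubular_def)
    qed
    have lm: "l (w y) = m" using e N by (simp add: l_def divide_eq_eq mult.commute)
    have "w y \<in> I" using y1 N m(1) lm by (simp add: I_def J2_def)
    moreover have "span {g (w y)} = span {\<gamma> (w y)}"
      unfolding g_def using Py by (intro span_scaleR_singleton) simp
    moreover have "t y = g (w y) - k (w y) *\<^sub>R f y"
    proof -
      have "\<gamma> (w y) = - lie_inner (\<gamma> (w y)) q *\<^sub>R f y - P (w y) *\<^sub>R t y"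
        using enveloped_sphere_decomposition(1)[OF env \<sigma>[OF y]] by (simp add: P_def)
      then have "g (w y) = (- 1 / P (w y)) *\<^sub>R (- lie_inner (\<gamma> (w y)) q *\<^sub>R f y - P (w y) *\<^sub>R t y)"
        by (simp add: g_def)
      also have "\<dots> = k (w y) *\<^sub>R f y + t y"
        using Py by (simp add: scaleR_diff_right k_def)
      finally show ?thesis by simp
    qed
    ultimately show ?thesis using \<sigma>[OF y] m(2) lm by simp
  qed
  show thesis
  proof (rule that[of W w I k l g])
    have "I \<subseteq> J1" using IJ2 J21 by blast
    then show "channel_data W w I k l g"
      unfolding channel_data_def
      using W(1,3) I smooth_on_subset[OF sk] smooth_on_subset[OF sl IJ2] smooth_on_subset[OF sg] kl y
      by (intro conjI ballI) auto
    show "x \<in> W" by (rule W(2))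
    show "\<forall>y\<in>W. \<sigma> y = span {g (w y)}" using y by blast
  qed
qed

end

section \<open>Isothermic coordinates\<close>

text \<open>A sum of a function of \<open>u\<close> and of a map that does not depend on \<open>u\<close> has vanishing mixed
  derivative.\<close>

lemma mixed_derivative_separated:
  fixes E :: "real \<Rightarrow> 'b::real_normed_vector"
  assumes A: "smooth_surface A" and C: "local_parameters A C" and sC: "snd C = (\<lambda>y. (w y, v y))"
    and F: "smooth_map_on A W F" "open W" "fst C \<subseteq> W" "\<And>y. y \<in> fst C \<Longrightarrow> dif C F y (1, 0) = 0"
    and E: "open I" "smooth_on I E" "w ` fst C \<subseteq> I"
    and s: "\<And>y. y \<in> fst C \<Longrightarrow> s y = E (w y) + \<epsilon> *\<^sub>R F y" and y: "y \<in> fst C"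
  shows "pd_v (pd_u (s \<circ> coord_inv C)) (snd C y) = 0"
proof -
  have tC: "topological_chart C" by (rule local_parameters_topological[OF C])
  let ?V = "snd C ` fst C"
  define E' where "E' r = frechet_derivative E (at r) 1" for r
  have V: "open ?V" using tC by (simp add: topological_chart_def)
  have u: "pd_u (s \<circ> coord_inv C) z = E' (fst z)" if z: "z \<in> ?V" for z
  proof -
    obtain y where y: "y \<in> fst C" "z = snd C y" using z by blast
    have cy: "coord_inv C (snd C y) = y" by (rule coord_inv_apply[OF tC y(1)])
    have dw: "((w \<circ> coord_inv C) has_derivative fst) (at (snd C y))"
    proof -
      have "((\<lambda>z. fst ((snd C \<circ> coord_inv C) z)) has_derivative fst) (at (snd C y))"
        using has_derivative_fst[OF has_dif_own_coordinates[OF tC y(1)]] by simp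
      then show ?thesis by (simp add: sC o_def)
    qed
    have dE: "(E has_vector_derivative E' (w y)) (at (w y))"
      unfolding E'_def using E(3) y(1) by (intro smooth_on_has_vector_derivative[OF E(2)]) auto
    have dF: "((F \<circ> coord_inv C) has_derivative dif C F y) (at (snd C y))"
      using F(3) y(1) by (intro dif_has_derivative[OF A C F(2,1)]) auto
    have "((\<lambda>z. \<epsilon> *\<^sub>R (F \<circ> coord_inv C) z) has_derivative (\<lambda>X. \<epsilon> *\<^sub>R dif C F y X)) (at (snd C y))"
      by (rule has_derivative_scaleR_right[OF dF])
    then have "(((\<lambda>y. \<epsilon> *\<^sub>R F y) \<circ> coord_inv C) has_derivative (\<lambda>X. \<epsilon> *\<^sub>R dif C F y X)) (at (snd C y))"
      by (simp add: o_def)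
    from dif_eqI[OF has_dif_add[OF has_dif_curve[OF dw cy dE] this]]
    have "dif C (\<lambda>y. E (w y) + \<epsilon> *\<^sub>R F y) y (1, 0) = E' (w y)"
      using F(4)[OF y(1)] by simp
    moreover have "dif C s y = dif C (\<lambda>y. E (w y) + \<epsilon> *\<^sub>R F y) y"
      using tC s y(1) by (intro dif_cong[of C "fst C"]) (auto simp: topological_chart_def)
    ultimately show ?thesis by (simp add: pd_u_def y(2) dif_def sC)
  qed
  have y': "snd C y \<in> ?V" using y by blast
  have "((\<lambda>z. E' (fst z)) has_derivative (\<lambda>X. frechet_derivative E' (at (w y)) (fst X))) (at (snd C y))"
  proof (rule has_derivative_compose[OF has_derivative_fst[OF has_derivative_ident]])
    have "(E' has_derivative frechet_derivative E' (at (w y))) (at (w y))"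
      unfolding E'_def[abs_def] using E(3) y
      by (intro smooth_on_has_derivative[OF smooth_on_frechet_derivative[OF E(2)]]) auto
    then show "(E' has_derivative frechet_derivative E' (at (w y))) (at (fst (snd C y)))"
      by (simp add: sC)
  qed
  then have d: "(pd_u (s \<circ> coord_inv C) has_derivative (\<lambda>X. frechet_derivative E' (at (w y)) (fst X)))
      (at (snd C y))"
    by (rule has_derivative_transform_within_open[OF _ V y']) (simp add: u)
  have "linear (frechet_derivative E' (at (w y)))"
    unfolding E'_def[abs_def] using E(3) y
    by (intro has_derivative_linear[OF smooth_on_has_derivative[OF smooth_on_frechet_derivative[OF E(2)]]]) auto
  then show ?thesis
    using frechet_derivative_at[OF d, symmetric] by (simp add: pd_v_def linear_0)
qed

text \<open>The functions by which the linear differential equation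
  \<open>(k - l) \<phi>' = g' - k' \<phi>\<close> is solved: \<open>\<rho> \<phi> - G\<close> is constant for every solution \<open>\<phi>\<close>.\<close>

lemma integrating_factor:
  fixes k l :: "real \<Rightarrow> real" and g :: "real \<Rightarrow> 'b::banach"
  assumes e: "0 < e" and k: "smooth_on (ball r0 e) k" and l: "smooth_on (ball r0 e) l"
    and g: "smooth_on (ball r0 e) g" and kl: "\<And>r. r \<in> ball r0 e \<Longrightarrow> k r \<noteq> l r"
  obtains d \<rho> G where "0 < d" "d \<le> e" "smooth_on (ball r0 d) \<rho>" "smooth_on (ball r0 d) G"
    "\<And>r. r \<in> ball r0 d \<Longrightarrow> \<rho> r \<noteq> 0"
    "\<And>r. r \<in> ball r0 d \<Longrightarrow>
      (\<rho> has_vector_derivative \<rho> r / (k r - l r) * frechet_derivative k (at r) 1) (at r)"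
    "\<And>r. r \<in> ball r0 d \<Longrightarrow>
      (G has_vector_derivative (\<rho> r / (k r - l r)) *\<^sub>R frechet_derivative g (at r) 1) (at r)"
proof -
  have "smooth_on (ball r0 e) (\<lambda>r. frechet_derivative k (at r) 1 / (k r - l r))"
    using kl by (intro smooth_on_divide smooth_on_diff smooth_on_frechet_derivative k l open_ball) auto
  then obtain d1 L where d1: "0 < d1" "d1 \<le> e" "smooth_on (ball r0 d1) L"
    and L: "\<And>r. r \<in> ball r0 d1 \<Longrightarrow>
      (L has_vector_derivative frechet_derivative k (at r) 1 / (k r - l r)) (at r)"
    using smooth_antiderivative[OF e] by blast
  define \<rho> where "\<rho> r = exp (L r)" for r
  have s\<rho>: "smooth_on (ball r0 d1) \<rho>"
    unfolding \<rho>_def[abs_def] by (intro smooth_on_exp open_ball d1)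
  have sub: "ball r0 d1 \<subseteq> ball r0 e" using d1(2) by auto
  have "smooth_on (ball r0 d1) (\<lambda>r. (\<rho> r / (k r - l r)) *\<^sub>R frechet_derivative g (at r) 1)"
    using kl sub smooth_on_subset[OF k sub] smooth_on_subset[OF l sub] smooth_on_subset[OF g sub]
    by (intro smooth_on_scaleR smooth_on_divide smooth_on_diff smooth_on_frechet_derivative s\<rho> open_ball) auto
  then obtain d2 G where d2: "0 < d2" "d2 \<le> d1" "smooth_on (ball r0 d2) G"
    and G: "\<And>r. r \<in> ball r0 d2 \<Longrightarrow>
      (G has_vector_derivative (\<rho> r / (k r - l r)) *\<^sub>R frechet_derivative g (at r) 1) (at r)"
    using smooth_antiderivative[OF d1(1)] by blast
  have sub2: "ball r0 d2 \<subseteq> ball r0 d1" using d2(2) by auto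
  have d\<rho>: "(\<rho> has_vector_derivative \<rho> r / (k r - l r) * frechet_derivative k (at r) 1) (at r)"
    if "r \<in> ball r0 d2" for r
  proof -
    have "(L has_real_derivative frechet_derivative k (at r) 1 / (k r - l r)) (at r)"
      using L[of r] that sub2 by (auto simp: has_real_derivative_iff_has_vector_derivative)
    from DERIV_fun_exp[OF this] show ?thesis
      by (simp add: \<rho>_def[abs_def] has_real_derivative_iff_has_vector_derivative)
  qed
  show thesis
    by (rule that[OF d2(1) _ smooth_on_subset[OF s\<rho> sub2] d2(3) _ d\<rho> G])
      (use d1(2) d2(2) in \<open>auto simp: \<rho>_def\<close>)
qed

context surface_with_tangent_planes
begin

text \<open>Along the second principal direction \<open>X\<close> the relation \<open>t = g(w) - k(w) f\<close> and
  \<open>dt(X) = - l df(X)\<close> combine to the linear equation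
  \<open>(k - l) df(X) = dw(X) (g'(w) - k'(w) f)\<close>; the derivatives of \<open>\<rho>\<close> and \<open>G\<close> are such that the
  right-hand side cancels in \<open>dF(X)\<close>. It also shows that \<open>dw(X)\<close> cannot vanish, since \<open>df(X)\<close> does
  not.\<close>

lemma channel_data_differential:
  assumes data: "channel_data W w I k l g"
    and C: "local_parameters A C" "y \<in> fst C" and y: "y \<in> W"
    and \<rho>: "(\<rho> has_vector_derivative \<rho> (w y) / (k (w y) - l (w y)) * frechet_derivative k (at (w y)) 1) (at (w y))"
    and G: "(G has_vector_derivative (\<rho> (w y) / (k (w y) - l (w y))) *\<^sub>R frechet_derivative g (at (w y)) 1) (at (w y))"
  defines "F \<equiv> \<lambda>y. \<rho> (w y) *\<^sub>R f y - G (w y)"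
  shows "((F \<circ> coord_inv C) has_derivative dif C F y) (at (snd C y))"
    and "dif C w y X = 0 \<Longrightarrow> dif C F y X = \<rho> (w y) *\<^sub>R dif C f y X"
    and "dif C t y X + l (w y) *\<^sub>R dif C f y X = 0 \<Longrightarrow> dif C F y X = 0"
    and "dif C t y X + l (w y) *\<^sub>R dif C f y X = 0 \<Longrightarrow> X \<noteq> 0 \<Longrightarrow> dif C w y X \<noteq> 0"
proof -
  note d = data[unfolded channel_data_def]
  have wI: "w y \<in> I" and kl: "k (w y) - l (w y) \<noteq> 0" using d y by auto
  have tC: "topological_chart C" by (rule local_parameters_topological[OF C(1)])
  note cy = coord_inv_apply[OF tC C(2)]
  have W: "open W" "smooth_map_on A W w" using d by auto
  have dw: "((w \<circ> coord_inv C) has_derivative dif C w y) (at (snd C y))"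
    by (rule has_dif[OF C(1) W C(2) y])
  define k' where "k' = frechet_derivative k (at (w y)) 1"
  define g' where "g' = frechet_derivative g (at (w y)) 1"
  have dk: "(k has_vector_derivative k') (at (w y))"
    unfolding k'_def using d wI by (intro smooth_on_has_vector_derivative[of I]) auto
  have dg: "(g has_vector_derivative g') (at (w y))"
    unfolding g'_def using d wI by (intro smooth_on_has_vector_derivative[of I]) auto
  let ?m = "\<rho> (w y) / (k (w y) - l (w y))"
  have hF: "((F \<circ> coord_inv C) has_derivative (\<lambda>X. (\<rho> (w y) *\<^sub>R dif C f y X +
      (dif C w y X *\<^sub>R (?m * k')) *\<^sub>R f y) - dif C w y X *\<^sub>R (?m *\<^sub>R g'))) (at (snd C y))"
    unfolding F_def k'_def g'_def
    by (rule has_dif_diff[OF has_dif_scaleR[OF has_dif_curve[OF dw cy \<rho>] cy has_dif_f[OF C]]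
          has_dif_curve[OF dw cy G]])
  then show "((F \<circ> coord_inv C) has_derivative dif C F y) (at (snd C y))"
    by (simp only: dif_eqI[OF hF])
  have dF: "dif C F y X = (\<rho> (w y) *\<^sub>R dif C f y X + (dif C w y X *\<^sub>R (?m * k')) *\<^sub>R f y)
      - dif C w y X *\<^sub>R (?m *\<^sub>R g')"
    by (rule fun_cong[OF dif_eqI[OF hF]])
  then show "dif C w y X = 0 \<Longrightarrow> dif C F y X = \<rho> (w y) *\<^sub>R dif C f y X" by simp
  have "dif C t y = dif C (\<lambda>y. g (w y) - k (w y) *\<^sub>R f y) y"
    using d by (intro dif_cong[OF tC W(1) _ C(2) y]) blast
  then have dt: "dif C t y X = dif C w y X *\<^sub>R g' -
      (k (w y) *\<^sub>R dif C f y X + (dif C w y X *\<^sub>R k') *\<^sub>R f y)"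
    using fun_cong[OF dif_eqI[OF has_dif_diff[OF has_dif_curve[OF dw cy dg]
          has_dif_scaleR[OF has_dif_curve[OF dw cy dk] cy has_dif_f[OF C]]]], of X] by simp
  assume X: "dif C t y X + l (w y) *\<^sub>R dif C f y X = 0"
  then have *: "(k (w y) - l (w y)) *\<^sub>R dif C f y X = dif C w y X *\<^sub>R (g' - k' *\<^sub>R f y)"
    unfolding dt by (simp add: algebra_simps)
  have "\<rho> (w y) *\<^sub>R dif C f y X = ?m *\<^sub>R ((k (w y) - l (w y)) *\<^sub>R dif C f y X)"
    using kl by simp
  also have "\<dots> = ?m *\<^sub>R (dif C w y X *\<^sub>R (g' - k' *\<^sub>R f y))" by (simp only: *)
  finally show "dif C F y X = 0" unfolding dF by (simp add: algebra_simps)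
  assume "X \<noteq> 0"
  then have "dif C f y X \<noteq> 0"
    using inj_dif_f[OF C] linear_injective_0[OF has_derivative_linear[OF has_dif_f[OF C]]] by blast
  then show "dif C w y X \<noteq> 0" using * kl by auto
qed

text \<open>In the coordinates \<open>(u, v)\<close> obtained here, \<open>u\<close> is the parameter of the enveloped family, and
  \<open>v\<close> is a component of \<open>F = \<rho>(w) f - G(w)\<close> whose derivative at \<open>x\<close> along the kernel of \<open>dw\<close> is
  non-zero. As \<open>F\<close>, and with it \<open>v\<close>, is constant along the second principal direction, that
  direction is the one of \<open>u\<close>, and \<open>F\<close> does not depend on \<open>u\<close>. The last conclusion is phrased for
  maps \<open>s\<close> composed of \<open>F\<close> and a function of \<open>u\<close>, because the lifts of \<open>\<langle>f\<rangle>\<close> and of \<open>\<langle>t\<rangle>\<close> are both of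
  this form.\<close>

lemma channel_data_coordinates:
  assumes data: "channel_data W w I k l g" and x: "x \<in> W"
  obtains C J \<rho> G where "local_parameters A C" "x \<in> fst C" "fst C \<subseteq> W"
    "open J" "J \<subseteq> I" "w ` fst C \<subseteq> J" "smooth_on J \<rho>" "smooth_on J G" "\<And>r. r \<in> J \<Longrightarrow> \<rho> r \<noteq> 0"
    "\<And>J' E s \<epsilon> y. open J' \<Longrightarrow> smooth_on J' E \<Longrightarrow> w ` fst C \<subseteq> J' \<Longrightarrow>
      (\<And>y. y \<in> fst C \<Longrightarrow> s y = E (w y) + \<epsilon> *\<^sub>R (\<rho> (w y) *\<^sub>R f y - G (w y))) \<Longrightarrow>
      y \<in> fst C \<Longrightarrow> pd_v (pd_u (s \<circ> coord_inv C)) (snd C y) = 0"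
proof -
  note d = data[unfolded channel_data_def]
  have "w x \<in> I" "open I" using d x by auto
  then obtain e where e: "0 < e" "ball (w x) e \<subseteq> I" using openE by blast
  have skl: "smooth_on (ball (w x) e) k" "smooth_on (ball (w x) e) l" "smooth_on (ball (w x) e) g"
    using d smooth_on_subset[OF _ e(2)] by auto
  have kl: "k u \<noteq> l u" if "u \<in> ball (w x) e" for u using d e(2) that by blast
  obtain r \<rho> G where r: "0 < r" "r \<le> e" and s: "smooth_on (ball (w x) r) \<rho>" "smooth_on (ball (w x) r) G"
    and \<rho>0: "\<And>u. u \<in> ball (w x) r \<Longrightarrow> \<rho> u \<noteq> 0"
    and \<rho>: "\<And>u. u \<in> ball (w x) r \<Longrightarrow>
      (\<rho> has_vector_derivative \<rho> u / (k u - l u) * frechet_derivative k (at u) 1) (at u)"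
    and G: "\<And>u. u \<in> ball (w x) r \<Longrightarrow>
      (G has_vector_derivative (\<rho> u / (k u - l u)) *\<^sub>R frechet_derivative g (at u) 1) (at u)"
    using integrating_factor[OF e(1) skl kl] by blast
  define J where "J = ball (w x) r"
  have J: "open J" "J \<subseteq> I" "w x \<in> J" using r e by (auto simp: J_def)
  define W' where "W' = W \<inter> w -` J"
  have W: "open W" "smooth_map_on A W w" using d by auto
  have W': "open W'" unfolding W'_def
    by (rule continuous_open_preimage[OF smooth_map_on_continuous_on[OF surface W] W(1) J(1)])
  have W'W: "W' \<subseteq> W" "w ` W' \<subseteq> J" "x \<in> W'" using x J(3) by (auto simp: W'_def)
  have data': "channel_data W' w J k l g"
    by (rule channel_data_subset[OF data W' W'W(1) J(1,2) W'W(2)])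
  have w: "smooth_map_on A W' w" by (rule smooth_map_on_subset[OF W(2) W'W(1)])
  define F where "F = (\<lambda>y. \<rho> (w y) *\<^sub>R f y - G (w y))"
  have sF: "smooth_map_on A W' F"
    unfolding F_def using s
    by (intro smooth_map_on_diff[OF surface W'] smooth_map_on_scaleR[OF surface W'] smooth_f
        smooth_map_on_compose[OF surface W' J(1) _ w W'W(2)]) (auto simp: J_def)
  have wJ: "w y \<in> ball (w x) r" if "y \<in> W'" for y using that by (simp add: W'_def J_def)
  note diff = channel_data_differential[OF data' _ _ _ \<rho>[OF wJ] G[OF wJ], folded F_def]
  obtain D where D: "D \<in> A" "x \<in> fst D" "local_parameters A D"
    using smooth_surface_chart[OF surface] by blast
  note diffD = diff[OF D(3,2) W'W(3) W'W(3) W'W(3)]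
  have dw: "((w \<circ> coord_inv D) has_derivative dif D w x) (at (snd D x))"
    by (rule has_dif[OF D(3) W' w D(2) W'W(3)])
  obtain X where X: "X \<noteq> 0" "dif D w x X = 0"
    using linear_plane_kernel[OF has_derivative_linear[OF dw]] by blast
  have "dif D f x X \<noteq> 0"
    using X(1) inj_dif_f[OF D(3,2)] linear_injective_0[OF has_derivative_linear[OF has_dif_f[OF D(3,2)]]]
    by blast
  then have "dif D F x X \<noteq> 0" using diffD(2)[OF X(2)] \<rho>0[OF wJ[OF W'W(3)]] by simp
  then obtain i where i: "dif D F x X $ i \<noteq> 0" by (auto simp: vec_eq_iff)
  define v where "v y = F y $ i" for y
  define \<phi> where "\<phi> = (\<lambda>y. (w y, v y))"
  have nth: "bounded_linear (\<lambda>z::real^6. z $ i)" by (rule bounded_linear_vec_nth)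
  have sv: "smooth_map_on A W' v"
    unfolding v_def[abs_def]
    by (rule smooth_map_on_compose[OF surface W' open_UNIV smooth_on_bounded_linear[OF open_UNIV nth] sF]) simp
  have s\<phi>: "smooth_map_on A W' \<phi>"
    unfolding \<phi>_def by (rule smooth_map_on_Pair[OF surface W' w sv])
  have "((\<phi> \<circ> coord_inv D) has_derivative (\<lambda>Z. (dif D w x Z, dif D F x Z $ i))) (at (snd D x))"
    using has_derivative_Pair[OF dw bounded_linear.has_derivative[OF nth diffD(1)]]
    by (simp add: \<phi>_def v_def o_def)
  note d\<phi> = dif_eqI[OF this] has_derivative_linear[OF this]
  have "inj (dif D \<phi> x)"
    unfolding d\<phi>(1) linear_injective_0[OF d\<phi>(2)]
  proof (intro allI impI)
    fix Z assume "(dif D w x Z, dif D F x Z $ i) = 0"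
    then have Z: "dif D w x Z = 0" "dif D F x Z $ i = 0" by (auto simp: prod_eq_iff)
    have "l (w x) \<in> principal_curvatures A f t x" using d x by blast
    then obtain Y where Y: "Y \<noteq> 0" "dif D t x Y + l (w x) *\<^sub>R dif D f x Y = 0"
      unfolding principal_curvatures_iff[OF D(3,2)] by blast
    obtain c where c: "Z = c *\<^sub>R X"
      using linear_plane_kernel_parallel[OF has_derivative_linear[OF dw] diffD(4)[OF Y(2,1)] X(2) Z(1) X(1)]
      by blast
    have "dif D F x Z = c *\<^sub>R dif D F x X"
      unfolding c by (rule linear_cmul[OF has_derivative_linear[OF diffD(1)]])
    then show "Z = 0" using c Z(2) i by simp
  qed
  then obtain C where C: "local_parameters A C" "x \<in> fst C" "fst C \<subseteq> W'" "snd C = \<phi>"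
    by (rule local_parametersI[OF surface W' s\<phi> W'W(3) D(1,2)])
  have tC: "topological_chart C" by (rule local_parameters_topological[OF C(1)])
  have Fu: "dif C F y (1, 0) = 0" if y: "y \<in> fst C" for y
  proof -
    have yW: "y \<in> W'" using y C(3) by blast
    note diffC = diff[OF C(1) y yW yW yW]
    have "l (w y) \<in> principal_curvatures A f t y" using d yW W'W(1) by blast
    then obtain X where X: "X \<noteq> 0" "dif C t y X + l (w y) *\<^sub>R dif C f y X = 0"
      unfolding principal_curvatures_iff[OF C(1) y] by blast
    have FX: "dif C F y X = 0" by (rule diffC(3)[OF X(2)])
    have "((snd C \<circ> coord_inv C) has_derivative (\<lambda>Z. (dif C w y Z, dif C F y Z $ i))) (at (snd C y))"
      using has_derivative_Pair[OF has_dif[OF C(1) W' w y yW]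
          bounded_linear.has_derivative[OF nth diffC(1)]]
      by (simp add: C(4) \<phi>_def v_def o_def)
    from has_derivative_unique[OF this has_dif_own_coordinates[OF tC y]]
    have "(dif C w y X, dif C F y X $ i) = X" by (rule fun_cong)
    then have "snd X = dif C F y X $ i" by (metis snd_conv)
    then have "snd X = 0" using FX by simp
    then have Xu: "X = fst X *\<^sub>R (1, 0)" and "fst X \<noteq> 0" using X(1) by (simp_all add: prod_eq_iff)
    have "fst X *\<^sub>R dif C F y (1, 0) = dif C F y (fst X *\<^sub>R (1, 0))"
      by (rule linear_cmul[OF has_derivative_linear[OF diffC(1)], symmetric])
    also have "\<dots> = 0" unfolding Xu[symmetric] by (rule FX)
    finally show ?thesis using \<open>fst X \<noteq> 0\<close> by simp
  qed
  show thesis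
  proof (rule that[OF C(1,2) _ J(1,2)])
    show "fst C \<subseteq> W" "w ` fst C \<subseteq> J" using C(3) W'W by auto
    show "smooth_on J \<rho>" "smooth_on J G" "\<And>r. r \<in> J \<Longrightarrow> \<rho> r \<noteq> 0"
      using s \<rho>0 by (auto simp: J_def)
    fix J' :: "real set" and E :: "real \<Rightarrow> real^6" and s \<epsilon> y
    assume "open J'" "smooth_on J' E" "w ` fst C \<subseteq> J'"
      "\<And>y. y \<in> fst C \<Longrightarrow> s y = E (w y) + \<epsilon> *\<^sub>R (\<rho> (w y) *\<^sub>R f y - G (w y))" "y \<in> fst C"
    then show "pd_v (pd_u (s \<circ> coord_inv C)) (snd C y) = 0"
      by (intro mixed_derivative_separated[OF surface C(1) C(4)[unfolded \<phi>_def] sF W' C(3) Fu])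
        (auto simp: F_def)
  qed
qed

lemma isothermic_point_sphere_congruence:
  assumes data: "channel_data W w I k l g" and x: "x \<in> W"
  shows "\<exists>C s. local_parameters A C \<and> x \<in> fst C \<and> moutard_lift A C (\<lambda>x. span {f x}) s"
proof -
  obtain C J \<rho> G where C: "local_parameters A C" "x \<in> fst C" "fst C \<subseteq> W"
    and J: "open J" "J \<subseteq> I" "w ` fst C \<subseteq> J" "smooth_on J \<rho>" "smooth_on J G" "\<And>r. r \<in> J \<Longrightarrow> \<rho> r \<noteq> 0"
    and pd: "\<And>J' E s \<epsilon> y. open J' \<Longrightarrow> smooth_on J' E \<Longrightarrow> w ` fst C \<subseteq> J' \<Longrightarrow>
      (\<And>y. y \<in> fst C \<Longrightarrow> s y = E (w y) + \<epsilon> *\<^sub>R (\<rho> (w y) *\<^sub>R f y - G (w y))) \<Longrightarrow>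
      y \<in> fst C \<Longrightarrow> pd_v (pd_u (s \<circ> coord_inv C)) (snd C y) = 0"
    using channel_data_coordinates[OF data x] by blast
  have oC: "open (fst C)"
    using local_parameters_topological[OF C(1)] by (simp add: topological_chart_def)
  have w: "smooth_map_on A (fst C) w"
    using data C(3) smooth_map_on_subset by (auto simp: channel_data_def)
  let ?s = "\<lambda>y. \<rho> (w y) *\<^sub>R f y"
  have "moutard_lift A C (\<lambda>x. span {f x}) ?s"
    unfolding moutard_lift_def
  proof (intro conjI ballI)
    show "smooth_map_on A (fst C) ?s"
      by (intro smooth_map_on_scaleR[OF surface oC] smooth_f
          smooth_map_on_compose[OF surface oC J(1,4) w J(3)])
    fix y assume y: "y \<in> fst C"
    show "span {?s y} = span {f y}" using J(3,6) y by (intro span_scaleR_singleton) auto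
    have "pd_v (pd_u (?s \<circ> coord_inv C)) (snd C y) = 0"
      by (rule pd[OF J(1,5,3) _ y, of _ 1]) simp
    then show "pd_v (pd_u (?s \<circ> coord_inv C)) (snd C y) \<in> span {?s y}" by (simp add: span_zero)
  qed
  then show ?thesis using C by blast
qed

text \<open>For \<open>k \<noteq> 0\<close> the equation \<open>k f = g - t\<close> turns the lift \<open>\<rho> f = G + F\<close> of the point spheres into
  \<open>(\<rho> / k) t = (\<rho> g / k - G) - F\<close>; for \<open>k = 0\<close> the map \<open>t = g\<close> depends on \<open>u\<close> alone.\<close>

lemma isothermic_tangent_plane_congruence:
  assumes data: "channel_data W w I k l g" and x: "x \<in> W"
    and k: "(\<forall>y\<in>W. k (w y) = 0) \<or> (\<forall>y\<in>W. k (w y) \<noteq> 0)"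
  shows "\<exists>C s. local_parameters A C \<and> x \<in> fst C \<and> moutard_lift A C (\<lambda>x. span {t x}) s"
proof -
  obtain C J \<rho> G where C: "local_parameters A C" "x \<in> fst C" "fst C \<subseteq> W"
    and J: "open J" "J \<subseteq> I" "w ` fst C \<subseteq> J" "smooth_on J \<rho>" "smooth_on J G" "\<And>r. r \<in> J \<Longrightarrow> \<rho> r \<noteq> 0"
    and pd: "\<And>J' E s \<epsilon> y. open J' \<Longrightarrow> smooth_on J' E \<Longrightarrow> w ` fst C \<subseteq> J' \<Longrightarrow>
      (\<And>y. y \<in> fst C \<Longrightarrow> s y = E (w y) + \<epsilon> *\<^sub>R (\<rho> (w y) *\<^sub>R f y - G (w y))) \<Longrightarrow>
      y \<in> fst C \<Longrightarrow> pd_v (pd_u (s \<circ> coord_inv C)) (snd C y) = 0"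
    using channel_data_coordinates[OF data x] by blast
  note d = data[unfolded channel_data_def]
  have oC: "open (fst C)"
    using local_parameters_topological[OF C(1)] by (simp add: topological_chart_def)
  have w: "smooth_map_on A (fst C) w"
    using d C(3) smooth_map_on_subset by auto
  have sg: "smooth_on J g" and sk: "smooth_on J k" using d smooth_on_subset[OF _ J(2)] by auto
  have t: "t y = g (w y) - k (w y) *\<^sub>R f y" if "y \<in> fst C" for y using that d C(3) by blast
  have "\<exists>s. moutard_lift A C (\<lambda>x. span {t x}) s"
  proof (cases "\<forall>y\<in>W. k (w y) = 0")
    case True
    have "pd_v (pd_u (t \<circ> coord_inv C)) (snd C y) = 0" if y: "y \<in> fst C" for y
      by (rule pd[OF J(1) sg J(3) _ y, of _ 0]) (use t True C(3) in auto)
    then have "moutard_lift A C (\<lambda>x. span {t x}) t"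
      by (simp add: moutard_lift_def smooth_t span_zero)
    then show ?thesis by blast
  next
    case False
    then have k0: "k (w y) \<noteq> 0" if "y \<in> W" for y using k that by blast
    define J' where "J' = J \<inter> k -` (- {0})"
    have J': "open J'" unfolding J'_def
      by (rule continuous_open_preimage[OF smooth_on_continuous_on[OF sk] J(1)]) auto
    have sub: "J' \<subseteq> J" and wJ': "w ` fst C \<subseteq> J'" using J(3) k0 C(3) by (auto simp: J'_def)
    let ?\<mu> = "\<lambda>r. \<rho> r / k r"
    have s\<mu>: "smooth_on J' ?\<mu>"
      using smooth_on_subset[OF J(4) sub] smooth_on_subset[OF sk sub]
      by (intro smooth_on_divide J') (auto simp: J'_def)
    have sE: "smooth_on J' (\<lambda>r. ?\<mu> r *\<^sub>R g r - G r)"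
      by (intro smooth_on_diff smooth_on_scaleR J' s\<mu> smooth_on_subset[OF sg sub] smooth_on_subset[OF J(5) sub])
    let ?s = "\<lambda>y. ?\<mu> (w y) *\<^sub>R t y"
    have "moutard_lift A C (\<lambda>x. span {t x}) ?s"
      unfolding moutard_lift_def
    proof (intro conjI ballI)
      show "smooth_map_on A (fst C) ?s"
        by (intro smooth_map_on_scaleR[OF surface oC] smooth_t
            smooth_map_on_compose[OF surface oC J' s\<mu> w wJ'])
      fix y assume y: "y \<in> fst C"
      show "span {?s y} = span {t y}"
        using J(3,6) y k0 C(3) by (intro span_scaleR_singleton) auto
      have "pd_v (pd_u (?s \<circ> coord_inv C)) (snd C y) = 0"
      proof (rule pd[OF J' sE wJ' _ y, of _ "-1"])
        fix y assume y: "y \<in> fst C"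
        then have "k (w y) \<noteq> 0" using k0 C(3) by blast
        then show "?s y = (?\<mu> (w y) *\<^sub>R g (w y) - G (w y)) + (-1) *\<^sub>R (\<rho> (w y) *\<^sub>R f y - G (w y))"
          by (simp add: t[OF y] scaleR_diff_right)
      qed
      then show "pd_v (pd_u (?s \<circ> coord_inv C)) (snd C y) \<in> span {?s y}" by (simp add: span_zero)
    qed
    then show ?thesis by blast
  qed
  then show ?thesis using C by blast
qed

end

section \<open>Channel linear Weingarten surfaces\<close>

theorem corollary4p6:
  fixes A :: "'m::{t2_space, second_countable_topology} chart set"
    and p q :: "real^6"
    and f t :: "'m \<Rightarrow> real^6"
    and \<sigma> :: "'m \<Rightarrow> (real^6) set"
    and a b c :: real
  assumes "smooth_surface A"
    and "lie_inner p p = -1" and "q \<noteq> 0" and "lie_inner q p = 0"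
    and "immersed_surface A p q f"
    and "tangent_plane_congruence A p q f t"
    and "umbilic_free A f t"
    and "envelops (legendre_lift f t) \<sigma>" and "one_parameter_family A \<sigma>"
    and "linear_weingarten A f t a b c" and "\<not> tubular a b c"
  shows "isothermic_on A UNIV (\<lambda>x. span {f x}) \<and>
    isothermic_on A (- frontier {x. span {t x} = \<sigma> x}) (\<lambda>x. span {t x})"
proof -
  interpret surface_with_tangent_planes A p q f t
    by (intro surface_with_tangent_planes.intro assms)
  note data = channel_linear_weingarten_data[OF assms(8,9,7,10,11)]
  have "isothermic_on A UNIV (\<lambda>x. span {f x})"
    unfolding isothermic_on_def
  proof
    fix x
    obtain W w I k l g where W: "x \<in> W" "channel_data W w I k l g" "\<forall>y\<in>W. \<sigma> y = span {g (w y)}"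
      by (rule data[of x])
    show "\<exists>C s. local_parameters A C \<and> x \<in> fst C \<and> moutard_lift A C (\<lambda>x. span {f x}) s"
      by (rule isothermic_point_sphere_congruence[OF W(2,1)])
  qed
  moreover have "isothermic_on A (- frontier {x. span {t x} = \<sigma> x}) (\<lambda>x. span {t x})"
    unfolding isothermic_on_def
  proof
    let ?S = "{x. span {t x} = \<sigma> x}"
    fix x assume x: "x \<in> - frontier ?S"
    obtain W w I k l g where W: "x \<in> W" "channel_data W w I k l g"
      and \<sigma>: "\<forall>y\<in>W. \<sigma> y = span {g (w y)}"
      by (rule data[of x])
    note d = W(2)[unfolded channel_data_def]
    have S: "y \<in> ?S \<longleftrightarrow> k (w y) = 0" if "y \<in> W" for y
    proof -
      have "t y = g (w y) - k (w y) *\<^sub>R f y" using d that by blast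
      from span_tangent_plane_iff[OF this] show ?thesis by (simp only: bspec[OF \<sigma> that] mem_Collect_eq)
    qed
    \<comment> \<open>off the frontier, a point is interior either to the set or to its complement\<close>
    have "\<exists>U. open U \<and> x \<in> U \<and> (U \<subseteq> ?S \<or> U \<subseteq> - ?S)"
    proof (cases "x \<in> interior ?S")
      case True
      then show ?thesis using interior_subset[of ?S] open_interior by blast
    next
      case False
      then have "x \<notin> closure ?S" using x by (simp add: frontier_def)
      then show ?thesis using closure_subset[of ?S] open_Compl[OF closed_closure, of ?S] by blast
    qed
    then obtain U where U: "open U" "x \<in> U" "U \<subseteq> ?S \<or> U \<subseteq> - ?S" by blast
    have "channel_data (W \<inter> U) w I k l g"
    proof (rule channel_data_subset[OF W(2)])
      show "open (W \<inter> U)" using d U(1) by blast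
      show "w ` (W \<inter> U) \<subseteq> I" using d by blast
    qed (use d in blast)+
    moreover have "(\<forall>y\<in>W \<inter> U. k (w y) = 0) \<or> (\<forall>y\<in>W \<inter> U. k (w y) \<noteq> 0)"
      using U(3) S by blast
    ultimately show "\<exists>C s. local_parameters A C \<and> x \<in> fst C \<and> moutard_lift A C (\<lambda>x. span {t x}) s"
      using W(1) U(2) by (intro isothermic_tangent_plane_congruence[of "W \<inter> U"] IntI)
  qed
  ultimately show ?thesis ..
qed

end
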